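(* Let $H$ be a fixed simple graph on the vertex set $[p]=\{1,\ldots,p\}$. Then $$\sum_{\lambda_1,\ldots,\lambda_p\geq0}\chi_{H[\lambda]}(q)\prod_{i=1}^p\frac{x_i^{\lambda_i}}{\lambda_i!}=B_H(x_1,\ldots,x_p)^q .$$ The identity holds coefficientwise as an identity of formal power series in $x_1,\ldots,x_p$, with coefficients polynomial in $q$ (hence for all complex $q$). Near the origin the right-hand side is $\exp(q\,\mathrm{Log}\,B_H)$ with the principal branch of $\mathrm{Log}$; here $B_H(0,\ldots,0)=1$.
   Context: For $\lambda=(\lambda_1,\ldots,\lambda_p)$ with $\lambda_i\ge0$, $H[\lambda]$ is the graph obtained from $H$ by replacing vertex $i$ with an independent set of size $\lambda_i$ and each edge $ij\in E(H)$ with all edges between the $i$-th and $j$-th sets. $\chi_G$ is the chromatic polynomial (equal to $1$ for the graph with no vertices). $\mathrm{Ind}(H)$ is the collection of independent sets of $H$, including the empty set, and $$B_H(x_1,\ldots,x_p)=\sum_{I\in\mathrm{Ind}(H)}\prod_{i\in I}(e^{x_i}-1).$$ *)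

theory Defs
  imports
    "HOL-Analysis.Analysis"
    "HOL-Computational_Algebra.Computational_Algebra"
    "HOL-Library.Poly_Mapping"
    "Graph_Theory.Pair_Digraph"
begin

section \<open>Graphs\<close>

text \<open>
  A finite simple graph is a symmetric loop-free digraph without parallel arcs, that is,
  \<^locale>\<open>pair_graph\<close>: an edge \<open>ij\<close> is represented by the two arcs \<open>(i, j)\<close> and \<open>(j, i)\<close>.
\<close>

definition blowup :: "'a pair_pre_digraph \<Rightarrow> ('a \<Rightarrow> nat) \<Rightarrow> ('a \<times> nat) pair_pre_digraph" where
  "blowup H l =
     \<lparr> pverts = (SIGMA i:pverts H. {..<l i}),
       parcs = {((i, a), (j, b)) | i a j b. (i, j) \<in> parcs H \<and> a < l i \<and> b < l j} \<rparr>"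

definition Ind :: "'a pair_pre_digraph \<Rightarrow> 'a set set" where
  "Ind H = {I. I \<subseteq> pverts H \<and> (\<forall>i\<in>I. \<forall>j\<in>I. (i, j) \<notin> parcs H)}"

definition proper_colourings :: "'a pair_pre_digraph \<Rightarrow> nat \<Rightarrow> ('a \<Rightarrow> nat) set" where
  "proper_colourings G k =
     {c \<in> pverts G \<rightarrow>\<^sub>E {..<k}. \<forall>(u, v) \<in> parcs G. c u \<noteq> c v}"

definition chromatic_poly :: "'a pair_pre_digraph \<Rightarrow> complex poly" where
  "chromatic_poly G =
     (THE P. \<forall>k. poly P (of_nat k) = of_nat (card (proper_colourings G k)))"

lemma pair_graph_blowup:
  assumes "pair_graph H"
  shows "pair_graph (blowup H l)"
proof -
  interpret pair_graph H by fact
  have sub: "parcs (blowup H l) \<subseteq> pverts (blowup H l) \<times> pverts (blowup H l)"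
    by (auto simp: blowup_def dest: in_arcsD1 in_arcsD2)
  have fin: "finite (pverts (blowup H l))"
    by (simp add: blowup_def)
  have "symmetric (with_proj (blowup H l))"
    using sym_arcs by (auto simp: symmetric_def sym_def blowup_def)
  moreover have "finite (parcs (blowup H l))"
    using finite_subset[OF sub] fin by blast
  moreover have "fst e \<noteq> snd e" if "e \<in> parcs (blowup H l)" for e
    using that no_loops' by (auto simp: blowup_def)
  ultimately show ?thesis
    using fin sub by unfold_locales auto
qed

lemma card_proper_colourings:
  assumes "pair_graph G"
  obtains s where
    "\<And>k. card (proper_colourings G k) = (\<Sum>j\<le>card (pverts G). s j * (k choose j))"
proof -
  interpret pair_graph G by fact
  define V where "V = pverts G"
  have fin: "finite V"
    by (simp add: V_def)
  define C where "C S = {c \<in> V \<rightarrow>\<^sub>E S. c ` V = S \<and> (\<forall>(u, v) \<in> parcs G. c u \<noteq> c v)}"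
    for S :: "nat set"
  define s where "s j = card (C {..<j})" for j
  have finC: "finite (C S)" if "finite S" for S
    by (rule finite_subset[OF _ finite_PiE[OF fin, of "\<lambda>_. S"]]) (auto simp: C_def that)
  have le: "card (C S) \<le> card (C T)" if ST: "finite S" "finite T" "card S = card T" for S T
  proof -
    obtain h where h: "bij_betw h S T"
      using finite_same_card_bij[OF ST] by blast
    have inj: "inj_on h S" and im: "h ` S = T"
      using h by (auto simp: bij_betw_def)
    let ?F = "\<lambda>c. restrict (h \<circ> c) V"
    have "?F c \<in> C T" if "c \<in> C S" for c
    proof -
      from that have c: "c ` V = S" "\<And>u v. (u, v) \<in> parcs G \<Longrightarrow> c u \<noteq> c v"
        by (auto simp: C_def)
      have "h (c u) \<noteq> h (c v)" if "(u, v) \<in> parcs G" for u v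
        using that c inj in_arcsD1[OF that] in_arcsD2[OF that]
        by (metis V_def imageI inj_onD)
      moreover have "(h \<circ> c) ` V = T"
        using c(1) im by (metis image_comp)
      ultimately show ?thesis
        using in_arcsD1 in_arcsD2 by (auto simp: C_def V_def)
    qed
    moreover have "inj_on ?F (C S)"
    proof (rule inj_onI)
      fix c d assume cd: "c \<in> C S" "d \<in> C S" "?F c = ?F d"
      show "c = d"
      proof (rule PiE_ext)
        show "c \<in> V \<rightarrow>\<^sub>E S" "d \<in> V \<rightarrow>\<^sub>E S"
          using cd by (auto simp: C_def)
        fix v assume v: "v \<in> V"
        then have "h (c v) = h (d v)"
          using fun_cong[OF cd(3), of v] by simp
        moreover have "c v \<in> S" "d v \<in> S"
          using cd v by (auto simp: C_def)
        ultimately show "c v = d v"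
          using inj by (simp add: inj_on_eq_iff)
      qed
    qed
    ultimately show ?thesis
      by (intro card_inj_on_le[of ?F] finC ST) auto
  qed
  have cardC: "card (C S) = s (card S)" if "finite S" for S
    unfolding s_def by (rule antisym; rule le) (simp_all add: that)
  have "card (proper_colourings G k) = (\<Sum>j\<le>card V. s j * (k choose j))" for k
  proof -
    have "proper_colourings G k = (\<Union>S\<in>Pow {..<k}. C S)"
      by (auto simp: proper_colourings_def C_def V_def PiE_def Pi_def)
    also have "card \<dots> = (\<Sum>S\<in>Pow {..<k}. card (C S))"
    proof (rule card_UN_disjoint)
      show "\<forall>S\<in>Pow {..<k}. finite (C S)"
        using finC finite_subset by blast
      show "\<forall>S\<in>Pow {..<k}. \<forall>T\<in>Pow {..<k}. S \<noteq> T \<longrightarrow> C S \<inter> C T = {}"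
        by (auto simp: C_def)
    qed simp
    also have "\<dots> = (\<Sum>S\<in>Pow {..<k}. s (card S))"
      using cardC finite_subset by (intro sum.cong) blast+
    also have "\<dots> = (\<Sum>j\<le>k. \<Sum>S\<in>{S \<in> Pow {..<k}. card S = j}. s (card S))"
      by (rule sum.group[symmetric]) (auto simp: subset_eq_atLeast0_lessThan_card lessThan_atLeast0)
    also have "\<dots> = (\<Sum>j\<le>k. s j * (k choose j))"
      using n_subsets[of "{..<k}"] by (intro sum.cong) (simp_all add: Pow_def)
    also have "\<dots> = (\<Sum>j\<le>k + card V. s j * (k choose j))"
      by (rule sum.mono_neutral_left) auto
    also have "\<dots> = (\<Sum>j\<le>card V. s j * (k choose j))"
    proof (rule sum.mono_neutral_right)
      have "s j = 0" if "card V < j" for j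
      proof -
        have "c ` V \<noteq> {..<j}" for c :: "_ \<Rightarrow> nat"
          using card_image_le[OF fin, of c] that by auto
        then have "C {..<j} = {}"
          by (simp add: C_def)
        then show ?thesis
          by (simp add: s_def)
      qed
      then show "\<forall>j\<in>{..k + card V} - {..card V}. s j * (k choose j) = 0"
        by auto
    qed auto
    finally show ?thesis .
  qed
  then show ?thesis
    using that unfolding V_def by blast
qed

lemma chromatic_poly_eval:
  assumes "pair_graph G"
  shows "poly (chromatic_poly G) (of_nat k) = of_nat (card (proper_colourings G k))"
proof -
  let ?is = "\<lambda>P. \<forall>k. poly P (of_nat k :: complex) = of_nat (card (proper_colourings G k))"
  obtain s where s:
    "\<And>k. card (proper_colourings G k) = (\<Sum>j\<le>card (pverts G). s j * (k choose j))"
    using card_proper_colourings[OF assms] by blast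
  define b :: "nat \<Rightarrow> complex poly" where
    "b j = smult (1 / fact j) (\<Prod>i<j. [:- of_nat i, 1:])" for j
  have b: "poly (b j) (of_nat k) = of_nat (k choose j)" for j k
    by (simp add: b_def poly_prod binomial_gbinomial gbinomial_prod_rev lessThan_atLeast0)
  have ex: "?is (\<Sum>j\<le>card (pverts G). smult (of_nat (s j)) (b j))"
    by (simp add: poly_sum b s)
  have uniq: "P = Q" if "?is P" "?is Q" for P Q
  proof (rule ccontr)
    assume "P \<noteq> Q"
    then have "finite {z. poly (P - Q) z = 0}"
      by (intro poly_roots_finite) auto
    moreover have "range of_nat \<subseteq> {z. poly (P - Q) z = 0}"
      using that by auto
    ultimately have "finite (range (of_nat :: nat \<Rightarrow> complex))"
      using finite_subset by blast
    then show False
      by (simp add: finite_image_iff inj_of_nat)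
  qed
  have "\<exists>!P. ?is P"
    by (rule ex_ex1I, rule exI, rule ex, rule uniq)
  from theI'[OF this] have "?is (chromatic_poly G)"
    unfolding chromatic_poly_def .
  then show ?thesis
    by blast
qed


section \<open>Multivariate formal power series\<close>

text \<open>
  The type \<open>'v\<close> of variables may be infinite: exponents have finite support, so that products are
  finite sums.
\<close>

typedef ('v, 'a) mfps = "UNIV :: (('v \<Rightarrow>\<^sub>0 nat) \<Rightarrow> 'a) set"
  morphisms mfps_nth Abs_mfps ..

lemma mfps_nth_Abs [simp]: "mfps_nth (Abs_mfps f) = f"
  by (simp add: Abs_mfps_inverse)

lemma mfps_eqI: "(\<And>m. mfps_nth f m = mfps_nth g m) \<Longrightarrow> f = g"
  by (metis ext mfps_nth_inject)

abbreviation splits :: "('v \<Rightarrow>\<^sub>0 nat) \<Rightarrow> (('v \<Rightarrow>\<^sub>0 nat) \<times> ('v \<Rightarrow>\<^sub>0 nat)) set" where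
  "splits m \<equiv> {(k, l). k + l = m}"

lemma finite_splits: "finite (splits m)"
proof -
  let ?F = "{f. \<forall>i.
      (i \<in> Poly_Mapping.keys m
        \<longrightarrow> f i \<in> {..Max (Poly_Mapping.lookup m ` Poly_Mapping.keys m)}) \<and>
      (i \<notin> Poly_Mapping.keys m \<longrightarrow> f i = (0::nat))}"
  have "finite ?F"
    by (intro finite_set_of_finite_funs) auto
  moreover have "Poly_Mapping.lookup ` {k. \<exists>l. k + l = m} \<subseteq> ?F"
    by (auto simp: lookup_add in_keys_iff intro!: le_trans[OF le_add1 Max_ge] image_eqI)
  ultimately have "finite {k. \<exists>l. k + l = m}"
    by (meson finite_imageD finite_subset injI inj_on_subset lookup_inject subset_UNIV)
  moreover have "splits m \<subseteq> (\<lambda>k. (k, m - k)) ` {k. \<exists>l. k + l = m}"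
    by auto
  ultimately show ?thesis
    using finite_surj by blast
qed

lemma sum_splits_Sigma:
  "(\<Sum>x\<in>splits m. \<Sum>y\<in>splits (g x). f x y)
     = (\<Sum>z\<in>(SIGMA x:splits m. splits (g x)). f (fst z) (snd z))"
proof -
  have "\<forall>x\<in>splits m. finite (splits (g x))"
    by (intro ballI finite_splits)
  from sum.Sigma[OF finite_splits this, of f] show ?thesis
    by (simp add: case_prod_beta')
qed

instantiation mfps :: (type, comm_ring_1) comm_ring_1
begin

definition "0 = Abs_mfps (\<lambda>_. 0)"
definition "1 = Abs_mfps (\<lambda>m. if m = 0 then 1 else 0)"
definition "f + g = Abs_mfps (\<lambda>m. mfps_nth f m + mfps_nth g m)"
definition "- f = Abs_mfps (\<lambda>m. - mfps_nth f m)"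
definition "f - g = Abs_mfps (\<lambda>m. mfps_nth f m - mfps_nth g m)"
definition "f * g = Abs_mfps (\<lambda>m. \<Sum>(k, l)\<in>splits m. mfps_nth f k * mfps_nth g l)"

instance
proof
  fix a b c :: "('a, 'b) mfps"
  show "a * b * c = a * (b * c)"
  proof (rule mfps_eqI)
    fix m
    let ?f = "mfps_nth a" and ?g = "mfps_nth b" and ?h = "mfps_nth c"
    have "mfps_nth (a * b * c) m =
        (\<Sum>x\<in>splits m. \<Sum>y\<in>splits (fst x). ?f (fst y) * ?g (snd y) * ?h (snd x))"
      by (simp add: times_mfps_def sum_distrib_right case_prod_unfold)
    also have "\<dots> = (\<Sum>z\<in>(SIGMA x:splits m. splits (fst x)).
        ?f (fst (snd z)) * ?g (snd (snd z)) * ?h (snd (fst z)))"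
      by (rule sum_splits_Sigma)
    also have "\<dots> = (\<Sum>z\<in>(SIGMA x:splits m. splits (snd x)).
        ?f (fst (fst z)) * (?g (fst (snd z)) * ?h (snd (snd z))))"
      by (rule sum.reindex_bij_witness[of _
            "\<lambda>z. ((fst (fst z) + fst (snd z), snd (snd z)), (fst (fst z), fst (snd z)))"
            "\<lambda>z. ((fst (snd z), snd (snd z) + snd (fst z)), (snd (snd z), snd (fst z)))"])
         (auto simp: algebra_simps)
    also have "\<dots> = (\<Sum>x\<in>splits m. \<Sum>y\<in>splits (snd x). ?f (fst x) * (?g (fst y) * ?h (snd y)))"
      by (rule sum_splits_Sigma[symmetric])
    also have "\<dots> = mfps_nth (a * (b * c)) m"
      by (simp add: times_mfps_def sum_distrib_left case_prod_unfold)
    finally show "mfps_nth (a * b * c) m = mfps_nth (a * (b * c)) m" .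
  qed
  show "a * b = b * a"
    unfolding times_mfps_def
    by (rule arg_cong[where f = Abs_mfps], rule ext,
        rule sum.reindex_bij_witness[where i = prod.swap and j = prod.swap])
       (auto simp: algebra_simps)
  show "1 * a = a"
  proof (rule mfps_eqI)
    fix m
    have "mfps_nth (1 * a) m =
        (\<Sum>x\<in>splits m. (if fst x = 0 then 1 else 0) * mfps_nth a (snd x))"
      by (simp add: times_mfps_def one_mfps_def case_prod_unfold)
    also have "\<dots> = (\<Sum>x\<in>{(0 :: 'a \<Rightarrow>\<^sub>0 nat, m)}. (if fst x = 0 then 1 else 0) * mfps_nth a (snd x))"
      by (rule sum.mono_neutral_right) (auto simp: finite_splits)
    finally show "mfps_nth (1 * a) m = mfps_nth a m"
      by simp
  qed
  show "(a + b) * c = a * c + b * c"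
    by (simp add: times_mfps_def plus_mfps_def distrib_right sum.distrib case_prod_unfold)
  have "mfps_nth (0 :: ('a, 'b) mfps) 0 \<noteq> mfps_nth (1 :: ('a, 'b) mfps) 0"
    by (simp add: zero_mfps_def one_mfps_def)
  then show "(0 :: ('a, 'b) mfps) \<noteq> 1"
    by metis
qed (simp_all add: zero_mfps_def plus_mfps_def uminus_mfps_def minus_mfps_def
      add_ac mfps_nth_inverse)

end

definition mfps_const :: "'a \<Rightarrow> ('v, 'a::comm_ring_1) mfps" where
  "mfps_const c = Abs_mfps (\<lambda>m. if m = 0 then c else 0)"

definition mfps_X :: "'v \<Rightarrow> ('v, 'a::comm_ring_1) mfps" where
  "mfps_X i = Abs_mfps (\<lambda>m. if m = Poly_Mapping.single i 1 then 1 else 0)"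

definition mdegree :: "('v \<Rightarrow>\<^sub>0 nat) \<Rightarrow> nat" where
  "mdegree m = (\<Sum>i\<in>Poly_Mapping.keys m. Poly_Mapping.lookup m i)"

text \<open>
  Substitution of \<open>F\<close> into a univariate series. It is meaningful only if \<open>F\<close> has constant term
  zero; then the coefficient of \<open>F ^ k\<close> at \<open>m\<close> vanishes for \<open>k > mdegree m\<close> (see
  \<open>mfps_nth_power_eq_0\<close> below), so that truncating the sum loses nothing.
\<close>

definition mfps_compose :: "'a fps \<Rightarrow> ('v, 'a::comm_ring_1) mfps \<Rightarrow> ('v, 'a) mfps" where
  "mfps_compose f F = Abs_mfps (\<lambda>m. \<Sum>k\<le>mdegree m. fps_nth f k * mfps_nth (F ^ k) m)"

lemma mdegree_add: "mdegree (k + l) = mdegree k + mdegree l"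
proof -
  have *: "mdegree m =
      (\<Sum>i\<in>Poly_Mapping.keys k \<union> Poly_Mapping.keys l. Poly_Mapping.lookup m i)"
    if "Poly_Mapping.keys m \<subseteq> Poly_Mapping.keys k \<union> Poly_Mapping.keys l" for m
    unfolding mdegree_def using that by (intro sum.mono_neutral_left) (auto simp: in_keys_iff)
  show ?thesis
    using keys_add[of k l] by (simp add: * lookup_add sum.distrib)
qed

lemma mfps_nth_power_eq_0:
  assumes "mfps_nth F 0 = 0" "mdegree m < k"
  shows "mfps_nth (F ^ k) m = 0"
  using assms(2)
proof (induction k arbitrary: m)
  case (Suc k)
  have "mfps_nth F a * mfps_nth (F ^ k) b = 0" if "a + b = m" for a b
  proof (cases "a = 0")
    case False
    then obtain i where "i \<in> Poly_Mapping.keys a"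
      by (metis all_not_in_conv keys_eq_empty)
    then have "mdegree a > 0"
      unfolding mdegree_def by (intro sum_pos2[of _ i]) (auto simp: in_keys_iff)
    with that Suc.prems have "mdegree b < k"
      by (auto simp: mdegree_add)
    then show ?thesis
      by (simp add: Suc.IH)
  qed (simp add: assms)
  then show ?case
    by (auto simp: times_mfps_def intro!: sum.neutral)
qed simp

text \<open>
  The coefficient ring below is meant to be \<^typ>\<open>complex\<close> or \<^typ>\<open>complex poly\<close>. In both cases
  the divisions are exact, and in \<^typ>\<open>complex\<close> they are the field division.
\<close>

definition mfps_exp :: "('v, 'a::{idom_divide, ring_char_0}) mfps \<Rightarrow> ('v, 'a) mfps" where
  "mfps_exp F = mfps_compose (Abs_fps (\<lambda>n. 1 div of_nat (fact n))) F"

text \<open>The logarithm of a series with constant term 1, by \<open>log (1 + t) = t - t\<^sup>2/2 + t\<^sup>3/3 - \<dots>\<close>.\<close>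

definition mfps_log :: "('v, 'a::{idom_divide, ring_char_0}) mfps \<Rightarrow> ('v, 'a) mfps" where
  "mfps_log F =
     mfps_compose (Abs_fps (\<lambda>n. if n = 0 then 0 else (- 1) ^ (n - 1) div of_nat n)) (F - 1)"

definition mfps_pow :: "('v, 'a::{idom_divide, ring_char_0}) mfps \<Rightarrow> 'a \<Rightarrow> ('v, 'a) mfps" where
  "mfps_pow F q = mfps_exp (mfps_const q * mfps_log F)"

lemma mfps_exp_complex: "mfps_exp F = mfps_compose (fps_exp (1 :: complex)) F"
  by (simp add: mfps_exp_def fps_exp_def)

lemma mfps_log_complex: "mfps_log F = mfps_compose (fps_ln (1 :: complex)) (F - 1)"
  by (simp add: mfps_log_def fps_ln_def)


section \<open>The independent set sum\<close>

definition B_fun :: "'v pair_pre_digraph \<Rightarrow> ('v \<Rightarrow> complex) \<Rightarrow> complex" where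
  "B_fun H x = (\<Sum>I\<in>Ind H. \<Prod>i\<in>I. (exp (x i) - 1))"

definition B_series :: "'v pair_pre_digraph \<Rightarrow> ('v, 'a::{idom_divide, ring_char_0}) mfps" where
  "B_series H = (\<Sum>I\<in>Ind H. \<Prod>i\<in>I. (mfps_exp (mfps_X i) - 1))"

lemma mfps_nth_0_mult:
  fixes F G :: "('v, 'a::comm_ring_1) mfps"
  shows "mfps_nth (F * G) 0 = mfps_nth F 0 * mfps_nth G 0"
proof -
  have "splits (0 :: 'v \<Rightarrow>\<^sub>0 nat) = {(0, 0)}"
    by (auto simp: poly_mapping_eq_iff lookup_add fun_eq_iff)
  then show ?thesis
    by (simp add: times_mfps_def)
qed

lemma mfps_nth_0_prod: "mfps_nth (\<Prod>i\<in>A. h i) 0 = (\<Prod>i\<in>A. mfps_nth (h i) 0)"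
  by (induction A rule: infinite_finite_induct)
     (simp_all add: mfps_nth_0_mult, simp_all add: one_mfps_def)

lemma mfps_nth_0_sum: "mfps_nth (\<Sum>i\<in>A. h i) 0 = (\<Sum>i\<in>A. mfps_nth (h i) 0)"
  by (induction A rule: infinite_finite_induct) (simp_all add: zero_mfps_def plus_mfps_def)

lemma B_series_nth_0:
  assumes "pair_graph H"
  shows "mfps_nth (B_series H :: ('v, 'a::{idom_divide, ring_char_0}) mfps) 0 = 1"
proof -
  interpret pair_graph H by fact
  have e: "mfps_nth (mfps_exp (mfps_X i) - 1 :: ('v, 'a) mfps) 0 = 0" for i
    by (simp add: mfps_exp_def mfps_compose_def mdegree_def minus_mfps_def one_mfps_def)
  have fin: "finite (Ind H)"
    by (rule finite_subset[of _ "Pow (pverts H)"]) (auto simp: Ind_def)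
  have "mfps_nth (B_series H :: ('v, 'a) mfps) 0 = (\<Sum>I\<in>Ind H. \<Prod>i\<in>I. 0 :: 'a)"
    by (simp only: B_series_def mfps_nth_0_sum mfps_nth_0_prod e)
  also have "\<dots> = (\<Sum>I\<in>{{} :: 'v set}. \<Prod>i\<in>I. 0 :: 'a)"
  proof (rule sum.mono_neutral_right)
    show "\<forall>I\<in>Ind H - {{}}. (\<Prod>i\<in>I. 0 :: 'a) = 0"
      using finite_subset[of _ "pverts H"] by (fastforce simp: Ind_def)
  qed (auto simp: fin Ind_def)
  finally show ?thesis
    by simp
qed

end

theory Submission
  imports Defs
begin

text \<open>
  For \<open>q = k\<close> a natural number, record a proper \<open>k\<close>-colouring of a blow-up by the set of blocks in
  which each colour occurs. These \<open>k\<close> sets are independent, and given them each block is coloured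
  by a surjection onto its set of colours, with exponential generating function
  \<open>(exp x\<^sub>i - 1) ^ a\<close> for \<open>a\<close> colours. Summing over all choices gives \<open>B ^ k\<close>. Since
  \<open>B ^ q = (\<Sum>k. (q gchoose k) * (B - 1) ^ k)\<close> has coefficients polynomial in \<open>q\<close>, the identity
  extends to all \<open>q\<close>. For convergence, the norm \<open>\<Sum>m. \<bar>F\<^sub>m x\<^sup>m\<bar>\<close> is submultiplicative and smaller
  than 1 for \<open>F = B - 1\<close> near the origin, so that the double sum over \<open>k\<close> and the exponents
  converges absolutely and may be rearranged.
\<close>


section \<open>Coefficients of the ring operations\<close>

lemma mfps_nth_0 [simp]: "mfps_nth 0 m = 0"
  by (simp add: zero_mfps_def)

lemma mfps_nth_1: "mfps_nth 1 m = (if m = 0 then 1 else 0)"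
  by (simp add: one_mfps_def)

lemma mfps_nth_add [simp]: "mfps_nth (F + G) m = mfps_nth F m + mfps_nth G m"
  by (simp add: plus_mfps_def)

lemma mfps_nth_minus [simp]: "mfps_nth (F - G) m = mfps_nth F m - mfps_nth G m"
  by (simp add: minus_mfps_def)

lemma mfps_nth_mult: "mfps_nth (F * G) m = (\<Sum>(k, l)\<in>splits m. mfps_nth F k * mfps_nth G l)"
  by (simp add: times_mfps_def)

lemma mfps_nth_sum: "mfps_nth (\<Sum>i\<in>A. h i) m = (\<Sum>i\<in>A. mfps_nth (h i) m)"
  by (induction A rule: infinite_finite_induct) simp_all

lemma mfps_const_1: "mfps_const 1 = 1"
  by (simp add: mfps_const_def one_mfps_def)

section \<open>Composition with a univariate series\<close>

text \<open>The cutoff in \<open>mfps_compose\<close> depends on the exponent. Any larger one will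
  do, so a common cutoff can serve for several exponents at once.\<close>

lemma mfps_nth_compose_trunc:
  assumes "mfps_nth F 0 = 0" "mdegree m \<le> N"
  shows "mfps_nth (mfps_compose f F) m = (\<Sum>k\<le>N. fps_nth f k * mfps_nth (F ^ k) m)"
  unfolding mfps_compose_def mfps_nth_Abs using assms
  by (intro sum.mono_neutral_left) (auto simp: mfps_nth_power_eq_0)

lemma mfps_compose_const: "mfps_compose (fps_const c) F = mfps_const c"
proof (rule mfps_eqI)
  fix m
  have "mfps_nth (mfps_compose (fps_const c) F) m =
      (\<Sum>k\<in>{0}. fps_nth (fps_const c) k * mfps_nth (F ^ k) m)"
    unfolding mfps_compose_def mfps_nth_Abs by (rule sum.mono_neutral_right) auto
  then show "mfps_nth (mfps_compose (fps_const c) F) m = mfps_nth (mfps_const c) m"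
    by (simp add: mfps_const_def mfps_nth_1)
qed

lemma mfps_compose_1: "mfps_compose 1 F = 1"
  using mfps_compose_const[of 1 F] by (simp add: mfps_const_1)

lemma mfps_compose_diff: "mfps_compose (f - g) F = mfps_compose f F - mfps_compose g F"
  by (rule mfps_eqI) (simp add: mfps_compose_def algebra_simps sum_subtractf)

lemma mfps_compose_mult:
  fixes F :: "('v, 'a::comm_ring_1) mfps"
  assumes F: "mfps_nth F 0 = 0"
  shows "mfps_compose (f * g) F = mfps_compose f F * mfps_compose g F"
proof (rule mfps_eqI)
  fix m :: "'v \<Rightarrow>\<^sub>0 nat"
  let ?d = "mdegree m"
  let ?t = "\<lambda>i j. fps_nth f i * fps_nth g j * mfps_nth (F ^ (i + j)) m"
  have "mfps_nth (mfps_compose (f * g) F) m = (\<Sum>k\<le>?d. \<Sum>i\<le>k. ?t i (k - i))"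
    by (simp add: mfps_compose_def fps_mult_nth sum_distrib_right atLeast0AtMost)
  also have "\<dots> = (\<Sum>(i, j)\<in>{(i, j). i + j \<le> ?d}. ?t i j)"
    by (rule sum.triangle_reindex_eq[symmetric])
  \<comment> \<open>The pairs with \<open>i + j > ?d\<close> contribute zero, since \<open>F\<close>
    has no constant term; a square of indices is what a product of two sums needs.\<close>
  also have "\<dots> = (\<Sum>(i, j)\<in>{..?d} \<times> {..?d}. ?t i j)"
    using mfps_nth_power_eq_0[OF F, of m]
    by (intro sum.mono_neutral_left) (auto simp flip: not_less)
  also have "\<dots> = (\<Sum>(i, j)\<in>{..?d} \<times> {..?d}. \<Sum>(k, l)\<in>splits m.
      (fps_nth f i * mfps_nth (F ^ i) k) * (fps_nth g j * mfps_nth (F ^ j) l))"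
    by (intro sum.cong refl)
       (simp add: case_prod_unfold power_add mfps_nth_mult sum_distrib_left mult_ac)
  also have "\<dots> = (\<Sum>(k, l)\<in>splits m. \<Sum>(i, j)\<in>{..?d} \<times> {..?d}.
      (fps_nth f i * mfps_nth (F ^ i) k) * (fps_nth g j * mfps_nth (F ^ j) l))"
    unfolding case_prod_unfold by (rule sum.swap)
  \<comment> \<open>Degrees add, so both parts of a splitting of \<open>m\<close> have degree at
    most \<open>?d\<close>, and \<open>?d\<close> is a valid cutoff for either factor.\<close>
  also have "\<dots> = (\<Sum>(k, l)\<in>splits m. mfps_nth (mfps_compose f F) k * mfps_nth (mfps_compose g F) l)"
    by (intro sum.cong refl)
       (auto simp: mfps_nth_compose_trunc[OF F, of _ ?d] mdegree_add sum_product sum.cartesian_product)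
  also have "\<dots> = mfps_nth (mfps_compose f F * mfps_compose g F) m"
    by (simp add: mfps_nth_mult)
  finally show "mfps_nth (mfps_compose (f * g) F) m = \<dots>" .
qed

lemma mfps_compose_power:
  assumes "mfps_nth F 0 = 0"
  shows "mfps_compose (f ^ n) F = mfps_compose f F ^ n"
  by (induction n) (simp_all add: mfps_compose_1 mfps_compose_mult[OF assms])

text \<open>Expand \<open>mfps_compose g F ^ i\<close> as the composition of \<open>g ^ i\<close>
  and exchange the sums. As \<open>g ^ i\<close> has order at least \<open>i\<close>, only the
  indices \<open>i \<le> k\<close> survive, as in the coefficients of \<open>f oo g\<close>.\<close>

lemma mfps_compose_assoc:
  fixes F :: "('v, 'a::comm_ring_1) mfps"
  assumes F: "mfps_nth F 0 = 0" and g: "fps_nth g 0 = 0"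
  shows "mfps_compose f (mfps_compose g F) = mfps_compose (f oo g) F"
proof (rule mfps_eqI)
  fix m :: "'v \<Rightarrow>\<^sub>0 nat"
  let ?d = "mdegree m"
  have "mfps_nth (mfps_compose f (mfps_compose g F)) m =
      (\<Sum>i\<le>?d. \<Sum>k\<le>?d. fps_nth f i * (fps_nth (g ^ i) k * mfps_nth (F ^ k) m))"
    by (simp add: mfps_compose_def[of f] mfps_compose_power[OF F, symmetric]
          mfps_nth_compose_trunc[OF F order_refl] sum_distrib_left)
  also have "\<dots> = (\<Sum>k\<le>?d. \<Sum>i\<le>?d. fps_nth f i * (fps_nth (g ^ i) k * mfps_nth (F ^ k) m))"
    by (rule sum.swap)
  also have "\<dots> = (\<Sum>k\<le>?d. \<Sum>i\<le>k. fps_nth f i * (fps_nth (g ^ i) k * mfps_nth (F ^ k) m))"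
    by (intro sum.cong refl sum.mono_neutral_right)
       (auto simp: startsby_zero_power_prefix[OF g])
  also have "\<dots> = mfps_nth (mfps_compose (f oo g) F) m"
    by (simp add: mfps_compose_def fps_compose_nth sum_distrib_left mult_ac atLeast0AtMost)
  finally show "mfps_nth (mfps_compose f (mfps_compose g F)) m = \<dots>" .
qed

text \<open>Both sides solve \<open>y' = q y / (1 + X)\<close> with constant term 1, and this
  initial value problem has a unique solution.\<close>

lemma fps_exp_compose_fps_ln:
  fixes q :: "'a::field_char_0"
  shows "fps_exp 1 oo (fps_const q * fps_ln 1) = fps_binomial q"
proof (subst fps_binomial_ODE_unique'[symmetric], intro conjI)
  show "fps_deriv (fps_exp 1 oo (fps_const q * fps_ln 1)) =
      fps_const q * (fps_exp 1 oo (fps_const q * fps_ln 1)) / (1 + fps_X)"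
    by (subst fps_compose_deriv) (simp_all add: fps_ln_deriv fps_divide_unit mult_ac)
qed simp

text \<open>Replaces the exponential of a logarithm by one binomial series, in which the dependence
  on \<open>q\<close> is explicit.\<close>

lemma mfps_pow_eq_compose_binomial:
  fixes F :: "('v, complex) mfps"
  assumes F: "mfps_nth F 0 = 1"
  shows "mfps_pow F q = mfps_compose (fps_binomial q) (F - 1)"
proof -
  have F1: "mfps_nth (F - 1) 0 = 0"
    using F by (simp add: mfps_nth_1)
  have "mfps_const q * mfps_log F = mfps_compose (fps_const q * fps_ln 1) (F - 1)"
    by (simp add: mfps_log_complex mfps_compose_mult[OF F1] mfps_compose_const)
  then show ?thesis
    by (simp add: mfps_pow_def mfps_exp_complex mfps_compose_assoc[OF F1] fps_exp_compose_fps_ln)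
qed

lemma mfps_compose_X:
  fixes f :: "'a::comm_ring_1 fps"
  assumes F: "mfps_nth F 0 = 0"
  shows "mfps_compose fps_X F = F"
proof (rule mfps_eqI)
  fix m
  \<comment> \<open>For \<open>m = 0\<close> the cutoff \<open>mdegree m\<close> would exclude the
    index 1, the only one at which \<open>fps_X\<close> has a coefficient.\<close>
  have "mfps_nth (mfps_compose fps_X F) m =
      (\<Sum>k\<le>max 1 (mdegree m). fps_nth fps_X k * mfps_nth (F ^ k) m)"
    by (rule mfps_nth_compose_trunc[OF F]) simp
  also have "\<dots> = (\<Sum>k\<in>{1}. fps_nth fps_X k * mfps_nth (F ^ k) m)"
    by (rule sum.mono_neutral_right) auto
  finally show "mfps_nth (mfps_compose fps_X F) m = mfps_nth F m"
    by simp
qed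

lemma mfps_pow_of_nat:
  fixes F :: "('v, complex) mfps"
  assumes F: "mfps_nth F 0 = 1"
  shows "mfps_pow F (of_nat n) = F ^ n"
proof -
  have F1: "mfps_nth (F - 1) 0 = 0"
    using F by (simp add: mfps_nth_1)
  have "mfps_compose (1 + fps_X) (F - 1) = F"
    using mfps_compose_diff[of "1 + fps_X" 1 "F - 1"]
    by (simp add: mfps_compose_X[OF F1] mfps_compose_1)
  then show ?thesis
    by (simp add: mfps_pow_eq_compose_binomial[OF F] fps_binomial_of_nat mfps_compose_power[OF F1])
qed


section \<open>Products of series in separate variables\<close>

lemma mfps_nth_X: "mfps_nth (mfps_X i) m = (if m = Poly_Mapping.single i 1 then 1 else 0)"
  by (simp add: mfps_X_def)

lemma mfps_nth_X_power:
  "mfps_nth (mfps_X i ^ n :: ('v, 'a::comm_ring_1) mfps) m = (if m = Poly_Mapping.single i n then 1 else 0)"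
proof (induction n arbitrary: m)
  case 0
  then show ?case
    by (simp add: mfps_nth_1)
next
  case (Suc n)
  have "mfps_nth (mfps_X i ^ Suc n :: ('v, 'a) mfps) m =
      (\<Sum>x\<in>splits m. if x = (Poly_Mapping.single i 1, Poly_Mapping.single i n) then 1 else 0)"
    by (auto simp: mfps_nth_mult Suc.IH mfps_nth_X intro!: sum.cong)
  also have "\<dots> = (if m = Poly_Mapping.single i (Suc n) then 1 else 0)"
    by (auto simp: sum.delta[OF finite_splits] single_add[symmetric])
  finally show ?case .
qed

lemma mfps_nth_X_0: "mfps_nth (mfps_X i) 0 = 0"
proof -
  have "Poly_Mapping.lookup 0 i \<noteq> Poly_Mapping.lookup (Poly_Mapping.single i (1 :: nat)) i"
    by simp
  then show ?thesis
    unfolding mfps_nth_X by metis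
qed

lemma keys_subset_singleton_iff:
  "Poly_Mapping.keys m \<subseteq> {i} \<longleftrightarrow> m = Poly_Mapping.single i (Poly_Mapping.lookup m i)"
  by (auto simp: poly_mapping_eq_iff fun_eq_iff lookup_single when_def in_keys_iff)

text \<open>At an exponent supported on \<open>i\<close> only one power of \<open>mfps_X i\<close>
  contributes, and its index equals the degree, so the truncation keeps it.\<close>

lemma mfps_nth_compose_X:
  "mfps_nth (mfps_compose f (mfps_X i)) m =
     (if Poly_Mapping.keys m \<subseteq> {i} then fps_nth f (Poly_Mapping.lookup m i) else 0)"
proof (cases "Poly_Mapping.keys m \<subseteq> {i}")
  case True
  then have m: "m = Poly_Mapping.single i (Poly_Mapping.lookup m i)"
    by (simp add: keys_subset_singleton_iff)
  have "mdegree m = Poly_Mapping.lookup m i"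
    unfolding mdegree_def using True
    by (subst sum.mono_neutral_left[of "{i}"]) (auto simp: in_keys_iff)
  moreover have "m = Poly_Mapping.single i k \<longleftrightarrow> k = Poly_Mapping.lookup m i" for k
    using m by (metis lookup_single_eq)
  ultimately show ?thesis
    using True by (simp add: mfps_compose_def mfps_nth_X_power if_distrib[of "(*) _"] cong: if_cong)
next
  case False
  then have "m \<noteq> Poly_Mapping.single i k" for k
    by (metis keys_subset_singleton_iff lookup_single_eq)
  then show ?thesis
    using False by (simp add: mfps_compose_def mfps_nth_X_power)
qed

text \<open>Induction on \<open>S\<close>: an exponent supported on \<open>insert j S\<close> splits
  in exactly one way into a part at \<open>j\<close> and a part on \<open>S\<close>, so the
  convolution has a single relevant term.\<close>

lemma mfps_nth_prod_compose_X:
  fixes f :: "'v \<Rightarrow> 'a::comm_ring_1 fps"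
  assumes "finite S"
  shows "mfps_nth (\<Prod>i\<in>S. mfps_compose (f i) (mfps_X i)) m =
     (if Poly_Mapping.keys m \<subseteq> S then \<Prod>i\<in>S. fps_nth (f i) (Poly_Mapping.lookup m i) else 0)"
  using assms
proof (induction S arbitrary: m rule: finite_induct)
  case empty
  then show ?case
    by (auto simp: mfps_nth_1)
next
  case (insert j S)
  let ?t = "\<lambda>k l. (if Poly_Mapping.keys k \<subseteq> {j} then fps_nth (f j) (Poly_Mapping.lookup k j) else 0) *
    (if Poly_Mapping.keys l \<subseteq> S then \<Prod>i\<in>S. fps_nth (f i) (Poly_Mapping.lookup l i) else 0)"
  have *: "mfps_nth (\<Prod>i\<in>insert j S. mfps_compose (f i) (mfps_X i)) m = (\<Sum>(k, l)\<in>splits m. ?t k l)"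
    using insert by (simp add: mfps_nth_mult mfps_nth_compose_X)
  show ?case
  proof (cases "Poly_Mapping.keys m \<subseteq> insert j S")
    case True
    define k where "k = Poly_Mapping.single j (Poly_Mapping.lookup m j)"
    define l where "l = m - k"
    have l: "Poly_Mapping.lookup l i = (if i = j then 0 else Poly_Mapping.lookup m i)" for i
      by (simp add: l_def k_def lookup_minus lookup_single when_def)
    have kl: "k + l = m"
      by (auto simp: poly_mapping_eq_iff fun_eq_iff lookup_add l) (auto simp: k_def lookup_single)
    have keys: "Poly_Mapping.keys k \<subseteq> {j}" "Poly_Mapping.keys l \<subseteq> S"
    proof -
      have "x \<noteq> j \<and> x \<in> Poly_Mapping.keys m" if "x \<in> Poly_Mapping.keys l" for x
        using that by (simp add: in_keys_iff l split: if_splits)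
      then show "Poly_Mapping.keys l \<subseteq> S"
        using True by blast
    qed (simp add: k_def)
    \<comment> \<open>Since \<open>j\<close> is not in \<open>S\<close>, the whole exponent of
      \<open>m\<close> at \<open>j\<close> must come from the first part, which determines both
      parts.\<close>
    have "k' = k \<and> l' = l"
      if "k' + l' = m" "Poly_Mapping.keys k' \<subseteq> {j}" "Poly_Mapping.keys l' \<subseteq> S" for k' l'
    proof -
      have "Poly_Mapping.lookup l' j = 0"
        using that insert.hyps by (auto simp: in_keys_iff)
      then have "k' = k"
        using that by (auto simp: k_def lookup_add keys_subset_singleton_iff)
      then show ?thesis
        using that kl by auto
    qed
    then have zero: "?t a b = 0" if "a + b = m" "(a, b) \<noteq> (k, l)" for a b
      using that by (cases "Poly_Mapping.keys a \<subseteq> {j} \<and> Poly_Mapping.keys b \<subseteq> S") auto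
    have "(\<Sum>(k, l)\<in>splits m. ?t k l) = (\<Sum>(k, l)\<in>{(k, l)}. ?t k l)"
    proof (rule sum.mono_neutral_right[OF finite_splits])
      show "\<forall>x\<in>splits m - {(k, l)}. (case x of (k, l) \<Rightarrow> ?t k l) = 0"
      proof
        fix x assume x: "x \<in> splits m - {(k, l)}"
        obtain a b where ab: "x = (a, b)"
          by (cases x)
        show "(case x of (k, l) \<Rightarrow> ?t k l) = 0"
          unfolding ab prod.case by (rule zero) (use x ab in auto)
      qed
    qed (simp add: kl)
    also have "\<dots> = fps_nth (f j) (Poly_Mapping.lookup m j) *
        (\<Prod>i\<in>S. fps_nth (f i) (Poly_Mapping.lookup m i))"
      using keys insert.hyps by (auto simp: l k_def intro!: prod.cong arg_cong2[of _ _ _ _ "(*)"])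
    finally show ?thesis
      using True insert.hyps * by simp
  next
    case False
    have "?t k l = 0" if "k + l = m" for k l
      using False keys_add[of k l] that by auto
    then show ?thesis
      using False * by (auto intro!: sum.neutral)
  qed
qed

section \<open>Counting colourings\<close>

text \<open>The binomial theorem with the subsets kept apart, to match a classification of functions
  into \<open>A\<close> by their image.\<close>

lemma power_card_eq_sum_Pow:
  fixes e :: "'a::comm_semiring_1"
  assumes "finite A"
  shows "(1 + e) ^ card A = (\<Sum>S\<in>Pow A. e ^ card S)"
  using prod_add[OF assms, of "\<lambda>_. e" "\<lambda>_. 1"] by (simp add: add.commute)

text \<open>Surjections are counted by sorting all functions into \<open>A\<close> by image. The
  numbers and the series satisfy the same recursion over subsets, so by induction the proper subsets
  cancel.\<close>

lemma fps_exp_minus_1_power_nth: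
  fixes A :: "'b set"
  assumes "finite A"
  shows "of_nat (card {f \<in> {..<n} \<rightarrow>\<^sub>E A. f ` {..<n} = A}) =
    fact n * fps_nth ((fps_exp (1 :: 'a::field_char_0) - 1) ^ card A) n"
  using assms
proof (induction A rule: finite_psubset_induct)
  case (psubset A)
  let ?s = "\<lambda>S :: 'b set. {f \<in> {..<n} \<rightarrow>\<^sub>E S. f ` {..<n} = S}"
  let ?e = "fps_exp (1 :: 'a) - 1"
  have fin: "finite (?s S)" if "S \<subseteq> A" for S
    using psubset.hyps finite_subset[OF that] by (simp add: finite_PiE)
  have "card A ^ n = card ({..<n} \<rightarrow>\<^sub>E A)"
    by (simp add: card_PiE)
  also have "{..<n} \<rightarrow>\<^sub>E A = (\<Union>S\<in>Pow A. ?s S)"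
    by (auto simp: PiE_def Pi_def)
  also have "card \<dots> = (\<Sum>S\<in>Pow A. card (?s S))"
  proof (rule card_UN_disjoint)
    show "finite (Pow A)"
      using psubset.hyps by simp
    show "\<forall>S\<in>Pow A. finite (?s S)"
      using fin by blast
    show "\<forall>S\<in>Pow A. \<forall>T\<in>Pow A. S \<noteq> T \<longrightarrow> ?s S \<inter> ?s T = {}"
      by blast
  qed
  also have "\<dots> = card (?s A) + (\<Sum>S\<in>Pow A - {A}. card (?s S))"
    using psubset.hyps by (intro sum.remove) auto
  finally have *: "card A ^ n = card (?s A) + (\<Sum>S\<in>Pow A - {A}. card (?s S))" .
  have "of_nat (card A) ^ n =
      of_nat (card (?s A)) + (\<Sum>S\<in>Pow A - {A}. of_nat (card (?s S)) :: 'a)"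
    using arg_cong[OF *, of "of_nat :: nat \<Rightarrow> 'a"] by (simp only: of_nat_add of_nat_power of_nat_sum)
  also have "(\<Sum>S\<in>Pow A - {A}. of_nat (card (?s S)) :: 'a) =
      (\<Sum>S\<in>Pow A - {A}. fact n * fps_nth (?e ^ card S) n)"
    by (intro sum.cong refl psubset.IH) auto
  finally have 1: "of_nat (card A) ^ n =
      of_nat (card (?s A)) + (\<Sum>S\<in>Pow A - {A}. fact n * fps_nth (?e ^ card S) n)" .
  \<comment> \<open>The recursion on the series side; \<open>fact n\<close> times the coefficient of
    this exponential at \<open>n\<close> is again \<open>card A ^ n\<close>.\<close>
  have "fps_exp (of_nat (card A)) = (1 + ?e) ^ card A"
    using fps_exp_power_mult[of "1 :: 'a" "card A"] by simp
  also have "\<dots> = (\<Sum>S\<in>Pow A. ?e ^ card S)"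
    by (rule power_card_eq_sum_Pow[OF psubset.hyps])
  finally have "fact n * fps_nth (fps_exp (of_nat (card A))) n =
      (\<Sum>S\<in>Pow A. fact n * fps_nth (?e ^ card S) n)"
    by (simp add: fps_sum_nth sum_distrib_left)
  also have "\<dots> = fact n * fps_nth (?e ^ card A) n + (\<Sum>S\<in>Pow A - {A}. fact n * fps_nth (?e ^ card S) n)"
    using psubset.hyps by (intro sum.remove) auto
  finally show ?case
    using 1 by simp
qed

text \<open>Currying: a function on a disjoint union is a family of functions on the blocks.
  Extensionality of the members of \<open>Q i\<close> makes restriction undo uncurrying.\<close>

lemma card_PiE_Sigma:
  assumes V: "finite V" and Q: "\<And>i. i \<in> V \<Longrightarrow> Q i \<subseteq> extensional (D i)"
  shows "card {c \<in> extensional (Sigma V D). \<forall>i\<in>V. (\<lambda>a\<in>D i. c (i, a)) \<in> Q i} = (\<Prod>i\<in>V. card (Q i))"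
proof -
  have "bij_betw (\<lambda>c. \<lambda>i\<in>V. \<lambda>a\<in>D i. c (i, a))
      {c \<in> extensional (Sigma V D). \<forall>i\<in>V. (\<lambda>a\<in>D i. c (i, a)) \<in> Q i} (PiE V Q)"
  proof (rule bij_betw_byWitness[where f' = "\<lambda>g. \<lambda>(i, a)\<in>Sigma V D. g i a"])
    have "(\<lambda>a\<in>D i. (\<lambda>(i, a)\<in>Sigma V D. g i a) (i, a)) = g i" if "g \<in> PiE V Q" "i \<in> V" for g i
      using that Q[of i] by (auto simp: fun_eq_iff restrict_def extensional_def PiE_def Pi_def)
    note restrict = this
    show "\<forall>g\<in>PiE V Q. (\<lambda>i\<in>V. \<lambda>a\<in>D i. (\<lambda>(i, a)\<in>Sigma V D. g i a) (i, a)) = g"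
    proof (rule ballI, rule ext)
      fix g i assume "g \<in> PiE V Q"
      then show "(\<lambda>i\<in>V. \<lambda>a\<in>D i. (\<lambda>(i, a)\<in>Sigma V D. g i a) (i, a)) i = g i"
        using restrict[of g i] PiE_arb[of g V Q i] by (cases "i \<in> V") simp_all
    qed
    show "(\<lambda>g. \<lambda>(i, a)\<in>Sigma V D. g i a) ` PiE V Q \<subseteq>
        {c \<in> extensional (Sigma V D). \<forall>i\<in>V. (\<lambda>a\<in>D i. c (i, a)) \<in> Q i}"
    proof (intro image_subsetI CollectI conjI ballI)
      fix g i assume "g \<in> PiE V Q" "i \<in> V"
      then show "(\<lambda>a\<in>D i. (\<lambda>(i, a)\<in>Sigma V D. g i a) (i, a)) \<in> Q i"
        using restrict[of g i] PiE_mem[of g V Q i] by simp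
    qed simp
  qed (auto simp: fun_eq_iff extensional_def)
  then show ?thesis
    by (simp add: bij_betw_same_card card_PiE V)
qed

text \<open>Let \<open>J t\<close> be the set of blocks in which colour \<open>t\<close> occurs.
  Adjacent blocks are completely joined and a block has no inner edges, so properness says exactly
  that every \<open>J t\<close> is independent. Given \<open>J\<close>, the blocks are coloured
  independently of each other, each by a surjection onto its prescribed colours.\<close>

lemma card_proper_colourings_blowup:
  assumes H: "finite (pverts H)" "parcs H \<subseteq> pverts H \<times> pverts H"
  shows "card (proper_colourings (blowup H l) k) = (\<Sum>J\<in>{..<k} \<rightarrow>\<^sub>E Ind H.
    \<Prod>i\<in>pverts H. card {f \<in> {..<l i} \<rightarrow>\<^sub>E {t \<in> {..<k}. i \<in> J t}. f ` {..<l i} = {t \<in> {..<k}. i \<in> J t}})"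
proof -
  let ?V = "pverts H" and ?D = "\<lambda>i. {..<l i}"
  let ?A = "\<lambda>J i. {t \<in> {..<k}. i \<in> J t}"
  let ?Q = "\<lambda>J i. {f \<in> ?D i \<rightarrow>\<^sub>E ?A J i. f ` ?D i = ?A J i}"
  define C where "C J = {c \<in> extensional (Sigma ?V ?D). \<forall>i\<in>?V. (\<lambda>a\<in>?D i. c (i, a)) \<in> ?Q J i}"
    for J :: "nat \<Rightarrow> 'a set"
  \<comment> \<open>The image condition already bounds the range, and the restriction is
    extensional. The defining form fits \<open>card_PiE_Sigma\<close>; this one is used for
    membership.\<close>
  have C: "C J = {c \<in> extensional (Sigma ?V ?D). \<forall>i\<in>?V. (\<lambda>a. c (i, a)) ` ?D i = ?A J i}" for J
    by (auto simp: C_def PiE_def Pi_def)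
  have fin: "finite (Ind H)"
    by (rule finite_subset[of _ "Pow ?V"]) (auto simp: Ind_def H)
  have mem: "c (i, a) < k" if "c \<in> C J" "i \<in> ?V" "a < l i" for c J i a
  proof -
    have "c (i, a) \<in> (\<lambda>a. c (i, a)) ` ?D i"
      using that by simp
    then show ?thesis
      using that by (auto simp: C)
  qed
  have "proper_colourings (blowup H l) k = (\<Union>J\<in>{..<k} \<rightarrow>\<^sub>E Ind H. C J)"
  proof (intro equalityI subsetI)
    fix c assume c: "c \<in> proper_colourings (blowup H l) k"
    define J where "J = (\<lambda>t\<in>{..<k}. {i \<in> ?V. \<exists>a<l i. c (i, a) = t})"
    have "J \<in> {..<k} \<rightarrow>\<^sub>E Ind H"
      using c by (fastforce simp: J_def Ind_def proper_colourings_def blowup_def)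
    moreover have "c \<in> C J"
      using c by (auto simp: C J_def proper_colourings_def blowup_def PiE_def Pi_def)
    ultimately show "c \<in> (\<Union>J\<in>{..<k} \<rightarrow>\<^sub>E Ind H. C J)"
      by blast
  next
    fix c assume "c \<in> (\<Union>J\<in>{..<k} \<rightarrow>\<^sub>E Ind H. C J)"
    then obtain J where J: "J \<in> {..<k} \<rightarrow>\<^sub>E Ind H" "c \<in> C J"
      by blast
    have "c (i, a) \<noteq> c (j, b)" if ij: "(i, j) \<in> parcs H" "a < l i" "b < l j" for i a j b
    proof
      assume eq: "c (i, a) = c (j, b)"
      have V: "i \<in> ?V" "j \<in> ?V"
        using ij H by auto
      \<comment> \<open>A colour shared by two adjacent blocks would put both ends of an edge into
        the independent set \<open>J ?t\<close>.\<close>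
      let ?t = "c (i, a)"
      have "?t \<in> (\<lambda>a. c (i, a)) ` ?D i" "?t \<in> (\<lambda>a. c (j, a)) ` ?D j"
        using ij eq by (blast intro: image_eqI)+
      then have "?t \<in> ?A J i" "?t \<in> ?A J j"
        using J(2) V by (auto simp: C)
      then show False
        using J(1) ij by (auto simp: PiE_def Pi_def Ind_def)
    qed
    then show "c \<in> proper_colourings (blowup H l) k"
      using mem[OF J(2)] J(2) by (auto simp: proper_colourings_def blowup_def PiE_def C)
  qed
  also have "card \<dots> = (\<Sum>J\<in>{..<k} \<rightarrow>\<^sub>E Ind H. card (C J))"
  proof (rule card_UN_disjoint)
    show "\<forall>J\<in>{..<k} \<rightarrow>\<^sub>E Ind H. finite (C J)"
    proof
      fix J
      have "C J \<subseteq> Sigma ?V ?D \<rightarrow>\<^sub>E {..<k}"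
        using mem by (auto simp: PiE_def C)
      then show "finite (C J)"
        by (rule finite_subset) (simp add: finite_PiE H)
    qed
    show "\<forall>J\<in>{..<k} \<rightarrow>\<^sub>E Ind H. \<forall>J'\<in>{..<k} \<rightarrow>\<^sub>E Ind H. J \<noteq> J' \<longrightarrow> C J \<inter> C J' = {}"
    proof (intro ballI impI, rule ccontr)
      fix J J' assume J: "J \<in> {..<k} \<rightarrow>\<^sub>E Ind H" "J' \<in> {..<k} \<rightarrow>\<^sub>E Ind H" "J \<noteq> J'" "C J \<inter> C J' \<noteq> {}"
      then obtain c where c: "c \<in> C J" "c \<in> C J'"
        by blast
      \<comment> \<open>The colouring determines the colours of each block, hence \<open>J\<close>;
        so the classes are disjoint.\<close>
      have A: "?A J i = ?A J' i" if "i \<in> ?V" for i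
      proof -
        have "(\<lambda>a. c (i, a)) ` ?D i = ?A J i" "(\<lambda>a. c (i, a)) ` ?D i = ?A J' i"
          using c that by (simp_all add: C)
        then show ?thesis
          by simp
      qed
      have "J t = J' t" if t: "t < k" for t
      proof -
        have "J t \<subseteq> ?V" "J' t \<subseteq> ?V"
          using J(1,2) t by (auto simp: PiE_def Pi_def Ind_def)
        moreover have "i \<in> J t \<longleftrightarrow> i \<in> J' t" if "i \<in> ?V" for i
          using A[OF that] t by blast
        ultimately show ?thesis
          by blast
      qed
      then show False
        using J(3) PiE_ext[OF J(1,2)] by blast
    qed
  qed (simp add: finite_PiE fin)
  also have "\<dots> = (\<Sum>J\<in>{..<k} \<rightarrow>\<^sub>E Ind H. \<Prod>i\<in>?V. card (?Q J i))"
    unfolding C_def by (intro sum.cong refl card_PiE_Sigma H) (auto simp: PiE_def)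
  finally show ?thesis .
qed

section \<open>Natural powers of the independent set sum\<close>

lemma B_series_complex:
  "B_series H = (\<Sum>I\<in>Ind H. \<Prod>i\<in>I. mfps_compose (fps_exp (1 :: complex) - 1) (mfps_X i))"
  by (simp add: B_series_def mfps_exp_complex mfps_compose_diff mfps_compose_1)

text \<open>Expanding the power chooses an independent set \<open>J t\<close> for every
  \<open>t < k\<close>. These are the families that index the colourings in
  \<open>card_proper_colourings_blowup\<close>.\<close>

lemma mfps_nth_B_series_power:
  fixes H :: "'v pair_pre_digraph"
  assumes H: "finite (pverts H)" "parcs H \<subseteq> pverts H \<times> pverts H"
  shows "mfps_nth (B_series H ^ k :: ('v, complex) mfps) m =
    (if Poly_Mapping.keys m \<subseteq> pverts H
     then of_nat (card (proper_colourings (blowup H (Poly_Mapping.lookup m)) k)) /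
       (\<Prod>i\<in>pverts H. fact (Poly_Mapping.lookup m i))
     else 0)"
proof -
  let ?V = "pverts H" and ?l = "Poly_Mapping.lookup m"
  let ?e = "fps_exp (1 :: complex) - 1"
  let ?E = "\<lambda>i. mfps_compose ?e (mfps_X i :: ('v, complex) mfps)"
  let ?A = "\<lambda>J i. {t \<in> {..<k}. i \<in> J t}"
  have fin: "finite (Ind H)"
    by (rule finite_subset[of _ "Pow ?V"]) (auto simp: Ind_def H)
  have "B_series H ^ k = (\<Prod>t<k. \<Sum>I\<in>Ind H. \<Prod>i\<in>I. ?E i)"
    by (simp add: B_series_complex)
  also have "\<dots> = (\<Sum>J\<in>{..<k} \<rightarrow>\<^sub>E Ind H. \<Prod>t<k. \<Prod>i\<in>J t. ?E i)"
    by (rule prod_sum_PiE) (simp_all add: fin)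
  also have "\<dots> = (\<Sum>J\<in>{..<k} \<rightarrow>\<^sub>E Ind H. \<Prod>i\<in>?V. mfps_compose (?e ^ card (?A J i)) (mfps_X i))"
  proof (rule sum.cong[OF refl])
    fix J assume J: "J \<in> {..<k} \<rightarrow>\<^sub>E Ind H"
    have "(\<Prod>t<k. \<Prod>i\<in>J t. ?E i) = (\<Prod>t<k. \<Prod>i\<in>{i \<in> ?V. i \<in> J t}. ?E i)"
    proof (rule prod.cong[OF refl])
      fix t assume "t \<in> {..<k}"
      then have "J t \<subseteq> ?V"
        using J by (auto simp: PiE_def Pi_def Ind_def)
      then have "{i \<in> ?V. i \<in> J t} = J t"
        by blast
      then show "(\<Prod>i\<in>J t. ?E i) = (\<Prod>i\<in>{i \<in> ?V. i \<in> J t}. ?E i)"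
        by simp
    qed
    \<comment> \<open>Regrouping by vertex: the factor of \<open>i\<close> occurs once for each
      \<open>t\<close> with \<open>i \<in> J t\<close>.\<close>
    also have "\<dots> = (\<Prod>i\<in>?V. \<Prod>t\<in>?A J i. ?E i)"
      using H by (intro prod.swap_restrict) auto
    finally show "(\<Prod>t<k. \<Prod>i\<in>J t. ?E i) =
        (\<Prod>i\<in>?V. mfps_compose (?e ^ card (?A J i)) (mfps_X i))"
      by (simp add: mfps_compose_power[OF mfps_nth_X_0])
  qed
  finally have "mfps_nth (B_series H ^ k :: ('v, complex) mfps) m =
      (if Poly_Mapping.keys m \<subseteq> ?V
       then \<Sum>J\<in>{..<k} \<rightarrow>\<^sub>E Ind H. \<Prod>i\<in>?V. fps_nth (?e ^ card (?A J i)) (?l i) else 0)"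
    using H by (simp add: mfps_nth_sum mfps_nth_prod_compose_X)
  \<comment> \<open>The surjection counts are \<open>fact (?l i)\<close> times these coefficients,
    which accounts for the denominator.\<close>
  moreover have "(\<Sum>J\<in>{..<k} \<rightarrow>\<^sub>E Ind H. \<Prod>i\<in>?V. fps_nth (?e ^ card (?A J i)) (?l i)) =
      of_nat (card (proper_colourings (blowup H ?l) k)) / (\<Prod>i\<in>?V. fact (?l i))"
    by (simp add: H card_proper_colourings_blowup fps_exp_minus_1_power_nth
          prod.distrib sum_distrib_left[symmetric])
  ultimately show ?thesis
    by simp
qed


section \<open>The coefficients as polynomials in the exponent\<close>

lemma poly_gbinomial:
  "poly (smult (1 / fact k) (\<Prod>i<k. [:- of_nat i, 1:])) (q :: 'a::field_char_0) = q gchoose k"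
  by (simp add: poly_prod gbinomial_prod_rev lessThan_atLeast0)

lemma poly_eqI_of_nat:
  fixes P Q :: "'a::{idom, ring_char_0} poly"
  assumes "\<And>n. poly P (of_nat n) = poly Q (of_nat n)"
  shows "P = Q"
proof (rule ccontr)
  assume "P \<noteq> Q"
  then have "finite {z. poly (P - Q) z = 0}"
    by (intro poly_roots_finite) auto
  moreover have "range of_nat \<subseteq> {z. poly (P - Q) z = 0}"
    using assms by auto
  ultimately show False
    using finite_subset finite_imageD[of "of_nat :: nat \<Rightarrow> 'a" UNIV] inj_of_nat infinite_UNIV_nat
    by blast
qed

text \<open>A finite combination of binomial coefficients of \<open>q\<close>, hence a polynomial in
  \<open>q\<close>.\<close>

lemma mfps_nth_pow:
  fixes F :: "('v, complex) mfps"
  assumes "mfps_nth F 0 = 1"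
  shows "mfps_nth (mfps_pow F q) m = (\<Sum>k\<le>mdegree m. (q gchoose k) * mfps_nth ((F - 1) ^ k) m)"
  by (simp add: mfps_pow_eq_compose_binomial[OF assms] mfps_compose_def)

theorem mfps_nth_B_series_pow:
  fixes H :: "'v pair_pre_digraph"
  assumes "pair_graph H"
  shows "mfps_nth (mfps_pow (B_series H) q :: ('v, complex) mfps) m =
    (if Poly_Mapping.keys m \<subseteq> pverts H
     then poly (chromatic_poly (blowup H (Poly_Mapping.lookup m))) q /
       (\<Prod>i\<in>pverts H. fact (Poly_Mapping.lookup m i))
     else 0)"
proof -
  interpret pair_graph H by fact
  let ?B = "B_series H :: ('v, complex) mfps"
  let ?p = "chromatic_poly (blowup H (Poly_Mapping.lookup m))"
  let ?f = "\<Prod>i\<in>pverts H. fact (Poly_Mapping.lookup m i) :: complex"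
  define P where "P = (\<Sum>k\<le>mdegree m. smult (mfps_nth ((?B - 1) ^ k) m)
    (smult (1 / fact k) (\<Prod>i<k. [:- of_nat i, 1:])))"
  define Q where "Q = (if Poly_Mapping.keys m \<subseteq> pverts H then smult (1 / ?f) ?p else 0)"
  have P: "poly P z = mfps_nth (mfps_pow ?B z) m" for z
    unfolding P_def poly_sum poly_smult[of "mfps_nth _ _"] poly_gbinomial
    by (simp add: mfps_nth_pow[OF B_series_nth_0[OF assms]] mult.commute)
  \<comment> \<open>At a natural exponent the formal power is an ordinary one, and both sides count
    proper \<open>n\<close>-colourings up to the factorials.\<close>
  have "poly P (of_nat n) = poly Q (of_nat n)" for n
    using in_arcsD1 in_arcsD2
    by (subst P, subst mfps_pow_of_nat[OF B_series_nth_0[OF assms]], subst mfps_nth_B_series_power)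
       (auto simp: Q_def chromatic_poly_eval[OF pair_graph_blowup[OF assms]])
  then have "P = Q"
    by (rule poly_eqI_of_nat)
  then show ?thesis
    using P[of q] by (simp add: Q_def split: if_splits)
qed

section \<open>Evaluation of polynomial coefficients\<close>

text \<open>Specializing the coefficients at each \<open>q\<close> reduces identities over
  \<open>complex poly\<close> to \<open>complex\<close>, where the series results for fields
  apply.\<close>

definition mfps_eval :: "'a::comm_ring_1 \<Rightarrow> ('v, 'a poly) mfps \<Rightarrow> ('v, 'a) mfps" where
  "mfps_eval q F = Abs_mfps (\<lambda>m. poly (mfps_nth F m) q)"

lemma mfps_nth_eval [simp]: "mfps_nth (mfps_eval q F) m = poly (mfps_nth F m) q"
  by (simp add: mfps_eval_def)

lemma mfps_eval_1: "mfps_eval q 1 = 1"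
  by (rule mfps_eqI) (simp add: mfps_nth_1)

lemma mfps_eval_diff: "mfps_eval q (F - G) = mfps_eval q F - mfps_eval q G"
  by (rule mfps_eqI) simp

lemma mfps_eval_mult: "mfps_eval q (F * G) = mfps_eval q F * mfps_eval q G"
  by (rule mfps_eqI) (simp add: mfps_nth_mult poly_sum case_prod_unfold)

lemma mfps_eval_power: "mfps_eval q (F ^ n) = mfps_eval q F ^ n"
  by (induction n) (simp_all add: mfps_eval_1 mfps_eval_mult)

lemma mfps_eval_sum: "mfps_eval q (\<Sum>i\<in>A. h i) = (\<Sum>i\<in>A. mfps_eval q (h i))"
  by (rule mfps_eqI) (simp add: mfps_nth_sum poly_sum)

lemma mfps_eval_prod: "mfps_eval q (\<Prod>i\<in>A. h i) = (\<Prod>i\<in>A. mfps_eval q (h i))"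
  by (induction A rule: infinite_finite_induct) (simp_all add: mfps_eval_1 mfps_eval_mult)

lemma mfps_eval_const: "mfps_eval q (mfps_const c) = mfps_const (poly c q)"
  by (rule mfps_eqI) (simp add: mfps_const_def)

lemma mfps_eval_X: "mfps_eval q (mfps_X i) = mfps_X i"
  by (rule mfps_eqI) (simp add: mfps_nth_X)

lemma mfps_eval_compose:
  "mfps_eval q (mfps_compose f F) =
     mfps_compose (Abs_fps (\<lambda>n. poly (fps_nth f n) q)) (mfps_eval q F)"
  by (rule mfps_eqI) (simp add: mfps_compose_def poly_sum flip: mfps_eval_power)

text \<open>Nonzero integers are units among the polynomials, so the divisions in
  \<open>mfps_exp\<close> and \<open>mfps_log\<close> commute with evaluation. For
  \<open>n = 0\<close> both quotients are 0 by convention.\<close>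

lemma poly_div_of_nat:
  fixes p :: "'a::field_char_0 poly"
  shows "poly (p div of_nat n) q = poly p q / of_nat n"
proof (cases "n = 0")
  case False
  have "of_nat n * smult (inverse (of_nat n)) p = p"
    using False by (simp add: of_nat_poly)
  then have "p div of_nat n = smult (inverse (of_nat n)) p"
    using False by (metis nonzero_mult_div_cancel_left of_nat_eq_0_iff)
  then show ?thesis
    by (simp add: field_simps)
qed simp

lemma mfps_eval_exp:
  fixes F :: "('v, 'a::field_char_0 poly) mfps"
  shows "mfps_eval q (mfps_exp F) = mfps_exp (mfps_eval q F)"
  by (simp add: mfps_exp_def mfps_eval_compose poly_div_of_nat del: of_nat_fact)

lemma mfps_eval_log:
  fixes F :: "('v, 'a::field_char_0 poly) mfps"
  shows "mfps_eval q (mfps_log F) = mfps_log (mfps_eval q F)"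
  by (simp add: mfps_log_def mfps_eval_compose poly_div_of_nat mfps_eval_diff mfps_eval_1
        if_distrib[of "\<lambda>p. poly p q"] cong: if_cong)

lemma mfps_eval_pow:
  fixes F :: "('v, 'a::field_char_0 poly) mfps"
  shows "mfps_eval q (mfps_pow F c) = mfps_pow (mfps_eval q F) (poly c q)"
  by (simp add: mfps_pow_def mfps_eval_exp mfps_eval_log mfps_eval_mult mfps_eval_const)

lemma mfps_eval_B_series:
  "mfps_eval q (B_series H :: ('v, 'a::field_char_0 poly) mfps) = B_series H"
  by (simp add: B_series_def mfps_eval_sum mfps_eval_prod mfps_eval_diff mfps_eval_exp
        mfps_eval_X mfps_eval_1)

text \<open>The exponent \<open>[:0, 1:]\<close> is the indeterminate, which evaluates to
  \<open>q\<close> itself; polynomials with equal values at all complex \<open>q\<close>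
  coincide.\<close>

theorem mfps_nth_B_series_pow_poly:
  fixes H :: "'v pair_pre_digraph"
  assumes "pair_graph H"
  shows "mfps_nth (mfps_pow (B_series H) [:0, 1:] :: ('v, complex poly) mfps) m =
    (if Poly_Mapping.keys m \<subseteq> pverts H
     then smult (1 / (\<Prod>i\<in>pverts H. fact (Poly_Mapping.lookup m i)))
       (chromatic_poly (blowup H (Poly_Mapping.lookup m)))
     else 0)" (is "?l = ?r")
proof -
  have "poly ?l q = poly ?r q" for q
  proof -
    have "poly ?l q = mfps_nth (mfps_pow (B_series H) q) m"
      using mfps_nth_eval[of q "mfps_pow (B_series H) [:0, 1:]" m]
      by (simp add: mfps_eval_pow mfps_eval_B_series)
    then show ?thesis
      by (simp add: mfps_nth_B_series_pow[OF assms])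
  qed
  then show ?thesis
    by (simp add: poly_eq_poly_eq_iff[symmetric] fun_eq_iff)
qed


section \<open>Convergence\<close>

definition mono_eval :: "('v \<Rightarrow> 'a::comm_semiring_1) \<Rightarrow> ('v \<Rightarrow>\<^sub>0 nat) \<Rightarrow> 'a" where
  "mono_eval x m = (\<Prod>i\<in>Poly_Mapping.keys m. x i ^ Poly_Mapping.lookup m i)"

lemma mono_eval_superset:
  assumes "finite S" "Poly_Mapping.keys m \<subseteq> S"
  shows "mono_eval x m = (\<Prod>i\<in>S. x i ^ Poly_Mapping.lookup m i)"
  unfolding mono_eval_def using assms
  by (intro prod.mono_neutral_left) (auto simp: in_keys_iff)

lemma mono_eval_add: "mono_eval x (k + l) = mono_eval x k * mono_eval x l"
proof -
  let ?S = "Poly_Mapping.keys k \<union> Poly_Mapping.keys l"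
  have "mono_eval x m = (\<Prod>i\<in>?S. x i ^ Poly_Mapping.lookup m i)"
    if "Poly_Mapping.keys m \<subseteq> ?S" for m
    using that by (intro mono_eval_superset) auto
  then show ?thesis
    using keys_add[of k l] by (simp add: lookup_add power_add prod.distrib)
qed

lemma mono_eval_0: "mono_eval x 0 = 1"
  by (simp add: mono_eval_def)

lemma mono_eval_single: "mono_eval x (Poly_Mapping.single i n) = x i ^ n"
  using mono_eval_superset[of "{i}" "Poly_Mapping.single i n" x] by simp

text \<open>The bound \<open>C\<close> is carried along because it is submultiplicative: powers of \<open>F\<close> are bounded by powers of \<open>C\<close>.\<close>

definition mfps_sums ::
    "('v \<Rightarrow> complex) \<Rightarrow> ('v, complex) mfps \<Rightarrow> complex \<Rightarrow> real \<Rightarrow> bool" where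
  "mfps_sums x F v C \<longleftrightarrow>
     ((\<lambda>m. mfps_nth F m * mono_eval x m) has_sum v) UNIV \<and>
     (\<exists>c\<le>C. ((\<lambda>m. norm (mfps_nth F m * mono_eval x m)) has_sum c) UNIV)"

text \<open>Any summable majorant suffices, so the exact sum of the norms need not be known for sums
  and products.\<close>

lemma mfps_sumsI:
  assumes "((\<lambda>m. mfps_nth F m * mono_eval x m) has_sum v) UNIV" "(g has_sum C) UNIV"
    and "\<And>m. norm (mfps_nth F m * mono_eval x m) \<le> g m"
  shows "mfps_sums x F v C"
proof -
  have "(\<lambda>m. norm (mfps_nth F m * mono_eval x m)) summable_on UNIV"
    by (rule Infinite_Sum.abs_summable_on_comparison_test'[OF has_sum_imp_summable[OF assms(2)] assms(3)])
  then have s: "((\<lambda>m. norm (mfps_nth F m * mono_eval x m)) has_sum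
      (\<Sum>\<^sub>\<infinity>m. norm (mfps_nth F m * mono_eval x m))) UNIV"
    by (rule has_sum_infsum)
  then have "(\<Sum>\<^sub>\<infinity>m. norm (mfps_nth F m * mono_eval x m)) \<le> C"
    by (rule has_sum_mono[OF _ assms(2)]) (use assms(3) in auto)
  then show ?thesis
    unfolding mfps_sums_def using s assms(1) by blast
qed

lemma mfps_sums_norm_le:
  assumes "mfps_sums x F v C"
  shows "norm v \<le> C"
proof -
  obtain c where c: "c \<le> C" "((\<lambda>m. norm (mfps_nth F m * mono_eval x m)) has_sum c) UNIV"
    and v: "((\<lambda>m. mfps_nth F m * mono_eval x m) has_sum v) UNIV"
    using assms unfolding mfps_sums_def by blast
  have "norm v \<le> c"
    by (rule norm_has_sum_bound[OF c(2) v])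
  then show ?thesis
    using c(1) by simp
qed

lemma mfps_sums_0: "mfps_sums x 0 0 0"
  by (rule mfps_sumsI[where g = "\<lambda>_. 0"]) simp_all

lemma mfps_sums_1: "mfps_sums x 1 1 1"
proof (rule mfps_sumsI[where g = "\<lambda>m. if m = 0 then 1 else 0"])
  show "((\<lambda>m. mfps_nth 1 m * mono_eval x m) has_sum 1) UNIV"
    by (rule has_sum_finite_neutralI[where B = "{0}"]) (auto simp: mfps_nth_1 mono_eval_0)
  show "((\<lambda>m. if m = 0 then 1 else 0 :: real) has_sum 1) (UNIV :: ('a \<Rightarrow>\<^sub>0 nat) set)"
    by (rule has_sum_finite_neutralI[where B = "{0}"]) auto
qed (auto simp: mfps_nth_1 mono_eval_0)

lemma mfps_sums_add:
  assumes "mfps_sums x F v C" "mfps_sums x G w D"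
  shows "mfps_sums x (F + G) (v + w) (C + D)"
proof -
  let ?f = "\<lambda>m. mfps_nth F m * mono_eval x m" and ?g = "\<lambda>m. mfps_nth G m * mono_eval x m"
  obtain c d where c: "c \<le> C" "((\<lambda>m. norm (?f m)) has_sum c) UNIV"
    and d: "d \<le> D" "((\<lambda>m. norm (?g m)) has_sum d) UNIV"
    and vw: "(?f has_sum v) UNIV" "(?g has_sum w) UNIV"
    using assms unfolding mfps_sums_def by blast
  have "mfps_sums x (F + G) (v + w) (c + d)"
  proof (rule mfps_sumsI)
    show "((\<lambda>m. mfps_nth (F + G) m * mono_eval x m) has_sum (v + w)) UNIV"
      using has_sum_add[OF vw] by (simp add: distrib_right)
    show "((\<lambda>m. norm (?f m) + norm (?g m)) has_sum (c + d)) UNIV"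
      by (rule has_sum_add[OF c(2) d(2)])
    show "norm (mfps_nth (F + G) m * mono_eval x m) \<le> norm (?f m) + norm (?g m)" for m
      using norm_triangle_ineq[of "?f m" "?g m"] by (simp add: distrib_right)
  qed
  then show ?thesis
    using c(1) d(1) unfolding mfps_sums_def by (meson add_mono order_trans)
qed

lemma mfps_sums_sum:
  assumes "\<And>i. i \<in> A \<Longrightarrow> mfps_sums x (F i) (v i) (C i)"
  shows "mfps_sums x (\<Sum>i\<in>A. F i) (\<Sum>i\<in>A. v i) (\<Sum>i\<in>A. C i)"
  using assms by (induction A rule: infinite_finite_induct) (simp_all add: mfps_sums_0 mfps_sums_add)

text \<open>Every pair of exponents lies in the finite set \<open>splits m\<close> for exactly one
  \<open>m\<close>, namely its sum; this groups a double series into a Cauchy product.\<close>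

lemma has_sum_splits:
  fixes f :: "('v \<Rightarrow>\<^sub>0 nat) \<times> ('v \<Rightarrow>\<^sub>0 nat) \<Rightarrow> 'a::{topological_comm_monoid_add, t3_space}"
  assumes "(f has_sum s) UNIV"
  shows "((\<lambda>m. \<Sum>y\<in>splits m. f y) has_sum s) UNIV"
proof (rule has_sum_SigmaD)
  have "((\<lambda>z. f (snd z)) has_sum s) (SIGMA m:UNIV. splits m) \<longleftrightarrow> (f has_sum s) UNIV"
    by (rule has_sum_reindex_bij_witness[where i = "\<lambda>y. (fst y + snd y, y)" and j = snd]) auto
  then show "((\<lambda>z. f (snd z)) has_sum s) (SIGMA m:UNIV. splits m)"
    using assms by blast
  show "((\<lambda>y. f (snd (m, y))) has_sum (\<Sum>y\<in>splits m. f y)) (splits m)" for m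
    by (simp add: has_sum_finite_iff finite_splits)
qed

text \<open>The norms are summed row by row first; the resulting absolute summability licenses the
  same iteration for the product itself.\<close>

lemma has_sum_product_abs:
  fixes f :: "'a \<Rightarrow> complex" and g :: "'b \<Rightarrow> complex"
  assumes f: "(f has_sum v) UNIV" "((\<lambda>k. norm (f k)) has_sum c) UNIV"
    and g: "(g has_sum w) UNIV" "((\<lambda>l. norm (g l)) has_sum d) UNIV"
  shows "((\<lambda>y. f (fst y) * g (snd y)) has_sum (v * w)) UNIV"
    and "((\<lambda>y. norm (f (fst y) * g (snd y))) has_sum (c * d)) UNIV"
proof -
  let ?h = "\<lambda>y. f (fst y) * g (snd y)"
  have k: "((\<lambda>l. norm (?h (k, l))) has_sum (norm (f k) * d)) UNIV" for k
    using has_sum_cmult_right[OF g(2)] by (simp add: norm_mult)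
  have cd: "((\<lambda>k. norm (f k) * d) has_sum (c * d)) UNIV"
    by (rule has_sum_cmult_left[OF f(2)])
  have summable: "(\<lambda>y. norm (?h y)) summable_on UNIV \<times> UNIV"
    by (rule summable_on_SigmaI[OF k]) (use cd in \<open>auto dest: has_sum_imp_summable\<close>)
  then show "((\<lambda>y. norm (?h y)) has_sum (c * d)) UNIV"
    using has_sum_SigmaI[where f = "\<lambda>y. norm (?h y)" and B = "\<lambda>_. UNIV", OF k cd]
    by simp
  have "((\<lambda>l. ?h (k, l)) has_sum (f k * w)) UNIV" for k
    using has_sum_cmult_right[OF g(1)] by simp
  from has_sum_SigmaI[where f = ?h and B = "\<lambda>_. UNIV", OF this has_sum_cmult_left[OF f(1)]]
  show "(?h has_sum (v * w)) UNIV"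
    using abs_summable_summable[OF summable] by simp
qed

lemma mfps_sums_mult:
  fixes F G :: "('v, complex) mfps"
  assumes "mfps_sums x F v C" "mfps_sums x G w D"
  shows "mfps_sums x (F * G) (v * w) (C * D)"
proof -
  let ?f = "\<lambda>m. mfps_nth F m * mono_eval x m" and ?g = "\<lambda>m. mfps_nth G m * mono_eval x m"
  obtain c d where c: "c \<le> C" "((\<lambda>m. norm (?f m)) has_sum c) UNIV"
    and d: "d \<le> D" "((\<lambda>m. norm (?g m)) has_sum d) UNIV"
    and vw: "(?f has_sum v) UNIV" "(?g has_sum w) UNIV"
    using assms unfolding mfps_sums_def by blast
  have nonneg: "0 \<le> c" "0 \<le> d"
    using has_sum_nonneg[OF c(2)] has_sum_nonneg[OF d(2)] by simp_all
  have term_eq: "mfps_nth (F * G) m * mono_eval x m = (\<Sum>y\<in>splits m. ?f (fst y) * ?g (snd y))" for m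
    unfolding mfps_nth_mult sum_distrib_right
    by (rule sum.cong) (auto simp: mono_eval_add)
  have "mfps_sums x (F * G) (v * w) (c * d)"
  proof (rule mfps_sumsI)
    show "((\<lambda>m. mfps_nth (F * G) m * mono_eval x m) has_sum (v * w)) UNIV"
      unfolding term_eq by (rule has_sum_splits[OF has_sum_product_abs(1)[OF vw(1) c(2) vw(2) d(2)]])
    show "((\<lambda>m. \<Sum>y\<in>splits m. norm (?f (fst y) * ?g (snd y))) has_sum (c * d)) UNIV"
      by (rule has_sum_splits[OF has_sum_product_abs(2)[OF vw(1) c(2) vw(2) d(2)]])
    show "norm (mfps_nth (F * G) m * mono_eval x m) \<le> (\<Sum>y\<in>splits m. norm (?f (fst y) * ?g (snd y)))" for m
      unfolding term_eq by (rule norm_sum)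
  qed
  moreover have "c * d \<le> C * D"
    using c(1) d(1) nonneg by (intro mult_mono) auto
  ultimately show ?thesis
    unfolding mfps_sums_def by (meson order_trans)
qed

lemma mfps_sums_prod:
  assumes "\<And>i. i \<in> A \<Longrightarrow> mfps_sums x (F i) (v i) (C i)"
  shows "mfps_sums x (\<Prod>i\<in>A. F i) (\<Prod>i\<in>A. v i) (\<Prod>i\<in>A. C i)"
  using assms by (induction A rule: infinite_finite_induct) (simp_all add: mfps_sums_1 mfps_sums_mult)

lemma mfps_sums_power:
  assumes "mfps_sums x F v C"
  shows "mfps_sums x (F ^ n) (v ^ n) (C ^ n)"
  using mfps_sums_prod[of "{..<n}" x "\<lambda>_. F" "\<lambda>_. v" "\<lambda>_. C"] assms by simp

text \<open>Only powers of the single variable \<open>i\<close> have nonzero coefficients, so the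
  sum over all exponents is the univariate one.\<close>

lemma mfps_sums_compose_X:
  fixes x :: "'v \<Rightarrow> complex"
  assumes "((\<lambda>n. fps_nth f n * x i ^ n) has_sum v) UNIV"
    and "((\<lambda>n. norm (fps_nth f n * x i ^ n)) has_sum C) UNIV"
  shows "mfps_sums x (mfps_compose f (mfps_X i)) v C"
proof -
  let ?t = "\<lambda>m. mfps_nth (mfps_compose f (mfps_X i)) m * mono_eval x m"
  let ?s = "Poly_Mapping.single i :: nat \<Rightarrow> _"
  have t: "?t (?s n) = fps_nth f n * x i ^ n" for n
    by (simp add: mfps_nth_compose_X mono_eval_single)
  have inj: "inj ?s"
    by (rule injI) (metis lookup_single_eq)
  have zero: "?t m = 0" if "m \<notin> range ?s" for m
    using that keys_subset_singleton_iff[of m i] by (auto simp: mfps_nth_compose_X)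
  have "(?t has_sum v) (range ?s)" "((\<lambda>m. norm (?t m)) has_sum C) (range ?s)"
    unfolding has_sum_reindex[OF inj] using assms by (simp_all add: comp_def t)
  moreover have "(?t has_sum v) (range ?s) \<longleftrightarrow> (?t has_sum v) UNIV"
    "((\<lambda>m. norm (?t m)) has_sum C) (range ?s) \<longleftrightarrow> ((\<lambda>m. norm (?t m)) has_sum C) UNIV"
    using zero by (intro has_sum_cong_neutral; simp)+
  ultimately show ?thesis
    unfolding mfps_sums_def by blast
qed

text \<open>Subtracting 1 removes just the term at \<open>n = 0\<close>. The remaining coefficients
  are nonnegative, so the norms form the same series at \<open>norm z\<close>.\<close>

lemma exp_minus_1_has_sum:
  fixes z :: complex
  shows "((\<lambda>n. fps_nth (fps_exp 1 - 1) n * z ^ n) has_sum (exp z - 1)) UNIV"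
    and "((\<lambda>n. norm (fps_nth (fps_exp (1 :: complex) - 1) n * z ^ n)) has_sum (exp (norm z) - 1)) UNIV"
proof -
  have term_eq: "fps_nth (fps_exp 1 - 1) n * y ^ n = y ^ n /\<^sub>R fact n - (if n = 0 then 1 else 0)"
    for n and y :: complex
    by (simp add: scaleR_conv_of_real field_simps)
  have norm_eq: "norm (fps_nth (fps_exp (1 :: complex) - 1) n * z ^ n) =
      norm z ^ n /\<^sub>R fact n - (if n = 0 then 1 else 0)" for n
    by (simp add: norm_mult norm_power norm_divide field_simps)
  have s: "(\<lambda>n. norm z ^ n /\<^sub>R fact n - (if n = 0 then 1 else 0)) sums (exp (norm z) - 1)"
    by (intro sums_diff exp_converges sums_single)
  then have summable: "summable (\<lambda>n. norm (fps_nth (fps_exp (1 :: complex) - 1) n * z ^ n))"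
    unfolding norm_eq by (rule sums_summable)
  show "((\<lambda>n. fps_nth (fps_exp 1 - 1) n * z ^ n) has_sum (exp z - 1)) UNIV"
    by (rule norm_summable_imp_has_sum[OF summable]) (unfold term_eq, intro sums_diff exp_converges sums_single)
  show "((\<lambda>n. norm (fps_nth (fps_exp (1 :: complex) - 1) n * z ^ n)) has_sum (exp (norm z) - 1)) UNIV"
    using s summable unfolding norm_eq[symmetric]
    by (intro norm_summable_imp_has_sum) (simp_all only: real_norm_def abs_norm_cancel)
qed

text \<open>The empty independent set contributes the constant 1. Every other term has a factor
  vanishing at the origin, and so does its bound.\<close>

lemma mfps_sums_B_series_minus_1:
  fixes H :: "'v pair_pre_digraph"
  assumes "finite (pverts H)"
  shows "mfps_sums x (B_series H - 1) (B_fun H x - 1)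
    (\<Sum>I\<in>Ind H - {{}}. \<Prod>i\<in>I. exp (norm (x i)) - 1)"
proof -
  have fin: "finite (Ind H)"
    by (rule finite_subset[of _ "Pow (pverts H)"]) (auto simp: Ind_def assms)
  have empty: "{} \<in> Ind H"
    by (simp add: Ind_def)
  let ?E = "\<lambda>i. mfps_compose (fps_exp (1 :: complex) - 1) (mfps_X i :: ('v, complex) mfps)"
  have "B_series H - 1 = (\<Sum>I\<in>Ind H - {{}}. \<Prod>i\<in>I. ?E i)"
    unfolding B_series_complex by (simp add: sum.remove[OF fin empty])
  moreover have "B_fun H x - 1 = (\<Sum>I\<in>Ind H - {{}}. \<Prod>i\<in>I. exp (x i) - 1)"
    unfolding B_fun_def by (simp add: sum.remove[OF fin empty])
  moreover have "mfps_sums x (?E i) (exp (x i) - 1) (exp (norm (x i)) - 1)" for i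
    by (intro mfps_sums_compose_X exp_minus_1_has_sum)
  ultimately show ?thesis
    by (simp only:) (intro mfps_sums_sum mfps_sums_prod)
qed

section \<open>Complex powers by the binomial series\<close>

lemma summable_norm_gbinomial:
  fixes q :: complex
  assumes "0 \<le> C" "C < 1"
  shows "summable (\<lambda>n. norm (q gchoose n) * C ^ n)"
proof -
  \<comment> \<open>The midpoint of \<open>C\<close> and 1: convergence at \<open>y\<close> gives
    absolute convergence at the strictly smaller radius \<open>C\<close>.\<close>
  define y where "y = complex_of_real ((1 + C) / 2)"
  have y: "norm y = (1 + C) / 2"
    using assms unfolding y_def norm_of_real by simp
  have "summable (\<lambda>n. (q gchoose n) * y ^ n)"
    using gen_binomial_complex[of y q] y assms by (auto dest: sums_summable)
  then have "summable (\<lambda>n. norm ((q gchoose n) * complex_of_real C ^ n))"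
    by (rule powser_insidea) (use y assms in simp)
  then show ?thesis
    using assms by (simp add: norm_mult norm_power)
qed

text \<open>The family \<open>?h\<close> is summed in two ways: over \<open>m\<close> first it gives
  the binomial series of \<open>(1 + v) powr q\<close>, over \<open>k\<close> first the terms of the
  formal power.\<close>

lemma has_sum_mfps_pow:
  fixes F :: "('v, complex) mfps"
  assumes F: "mfps_nth F 0 = 1" and sums: "mfps_sums x (F - 1) v C" and C: "C < 1"
  shows "((\<lambda>m. mfps_nth (mfps_pow F q) m * mono_eval x m) has_sum ((1 + v) powr q)) UNIV"
proof -
  let ?t = "\<lambda>k m. mfps_nth ((F - 1) ^ k) m * mono_eval x m"
  let ?h = "\<lambda>y. (q gchoose fst y) * ?t (fst y) (snd y)"
  have v: "norm v \<le> C"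
    by (rule mfps_sums_norm_le[OF sums])
  then have C0: "0 \<le> C"
    using norm_ge_zero order_trans by blast
  have "\<exists>c\<le>C ^ k. ((\<lambda>m. norm (?t k m)) has_sum c) UNIV" for k
    using mfps_sums_power[OF sums, of k] unfolding mfps_sums_def by blast
  then obtain c where c: "\<And>k. c k \<le> C ^ k" "\<And>k. ((\<lambda>m. norm (?t k m)) has_sum c k) UNIV"
    by metis
  have c0: "0 \<le> c k" for k
    using has_sum_nonneg[OF c(2)] by simp
  \<comment> \<open>The row sums of norms are dominated by the binomial series at
    \<open>C < 1\<close>.\<close>
  have "summable (\<lambda>k. norm (norm (q gchoose k) * c k))"
    by (rule summable_comparison_test'[OF summable_norm_gbinomial[OF C0 C, of q]])
       (use c c0 in \<open>auto simp: abs_mult intro!: mult_left_mono\<close>)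
  then have "(\<lambda>k. norm (q gchoose k) * c k) summable_on UNIV"
    by (rule norm_summable_imp_summable_on)
  moreover have "((\<lambda>m. norm (?h (k, m))) has_sum (norm (q gchoose k) * c k)) UNIV" for k
    using has_sum_cmult_right[OF c(2), of "norm (q gchoose k)"] by (simp add: norm_mult mult.assoc)
  ultimately have "(\<lambda>y. norm (?h y)) summable_on UNIV \<times> UNIV"
    by (intro summable_on_SigmaI[where g = "\<lambda>k. norm (q gchoose k) * c k"]) auto
  then have summable: "?h summable_on UNIV \<times> UNIV"
    by (rule abs_summable_summable)
  have "((\<lambda>k. (q gchoose k) * v ^ k) has_sum ((1 + v) powr q)) UNIV"
  proof (rule norm_summable_imp_has_sum)
    show "summable (\<lambda>k. norm ((q gchoose k) * v ^ k))"
      using summable_norm_gbinomial[of "norm v" q] v C by (simp add: norm_mult norm_power)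
    show "(\<lambda>k. (q gchoose k) * v ^ k) sums ((1 + v) powr q)"
      using v C by (intro gen_binomial_complex) simp
  qed
  moreover have "((\<lambda>m. ?h (k, m)) has_sum ((q gchoose k) * v ^ k)) UNIV" for k
    using mfps_sums_power[OF sums, of k] unfolding mfps_sums_def
    by (simp add: has_sum_cmult_right)
  ultimately have "(?h has_sum ((1 + v) powr q)) (UNIV \<times> UNIV)"
    by (intro has_sum_SigmaI[OF _ _ summable]) auto
  then have swap: "((\<lambda>y. ?h (snd y, fst y)) has_sum ((1 + v) powr q)) (UNIV \<times> UNIV)"
    by (subst has_sum_reindex_bij_witness[where i = prod.swap and j = prod.swap and T = "UNIV \<times> UNIV" and h = ?h])
       auto
  show ?thesis
  proof (rule has_sum_SigmaD[OF swap])
    fix m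
    have F1: "mfps_nth (F - 1) 0 = 0"
      using F by (simp add: mfps_nth_1)
    show "((\<lambda>k. ?h (snd (m, k), fst (m, k))) has_sum mfps_nth (mfps_pow F q) m * mono_eval x m) UNIV"
      \<comment> \<open>At fixed \<open>m\<close> the sum over \<open>k\<close> is finite, because
        high powers of \<open>F - 1\<close> have no coefficient there.\<close>
      by (rule has_sum_finite_neutralI[where B = "{..mdegree m}"])
         (simp_all add: mfps_nth_power_eq_0[OF F1] mfps_nth_pow[OF F] sum_distrib_right mult.assoc)
  qed
qed

text \<open>At the origin the bound on \<open>norm (B_fun H x - 1)\<close> is zero: each product
  over a nonempty set has factors \<open>exp 0 - 1\<close>.\<close>

lemma B_fun_0:
  assumes "finite (pverts H)"
  shows "B_fun H (\<lambda>_. 0) = 1"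
proof -
  have "B_fun H (\<lambda>_. 0) - 1 = 0"
    using mfps_sums_norm_le[OF mfps_sums_B_series_minus_1[OF assms, of "\<lambda>_. 0"]]
      finite_subset[OF _ assms]
    by (subst (asm) sum.neutral) (auto simp: Ind_def)
  then show ?thesis
    by simp
qed

text \<open>Replacing all norms by a common bound \<open>t\<close> leaves a continuous function of
  one real variable that vanishes at 0.\<close>

lemma independent_sum_bound_less_1:
  assumes "finite (pverts H)"
  obtains r :: real where "r > 0"
    "\<And>x :: _ \<Rightarrow> complex. \<forall>i\<in>pverts H. norm (x i) < r \<Longrightarrow>
       (\<Sum>I\<in>Ind H - {{}}. \<Prod>i\<in>I. exp (norm (x i)) - 1) < 1"
proof -
  let ?f = "\<lambda>t :: real. \<Sum>I\<in>Ind H - {{}}. (exp t - 1) ^ card I"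
  have "?f 0 = 0"
    using finite_subset[OF _ assms] by (intro sum.neutral) (auto simp: Ind_def card_gt_0_iff)
  moreover have "isCont ?f 0"
    by (intro continuous_intros)
  ultimately have "\<forall>\<^sub>F t in at 0. ?f t < 1"
    by (intro order_tendstoD) (auto simp: isCont_def)
  then obtain d where d: "d > 0" "\<And>t. t \<noteq> 0 \<Longrightarrow> dist t 0 < d \<Longrightarrow> ?f t < 1"
    unfolding eventually_at by auto
  show ?thesis
  proof
    \<comment> \<open>Half of \<open>d\<close>, since \<open>?f\<close> is evaluated at the radius
      itself, which must lie strictly within \<open>d\<close> of 0.\<close>
    show "d / 2 > 0"
      using d by simp
    fix x :: "_ \<Rightarrow> complex" assume x: "\<forall>i\<in>pverts H. norm (x i) < d / 2"
    have "(\<Sum>I\<in>Ind H - {{}}. \<Prod>i\<in>I. exp (norm (x i)) - 1) \<le> ?f (d / 2)"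
    proof (rule sum_mono)
      fix I assume "I \<in> Ind H - {{}}"
      then have "(\<Prod>i\<in>I. exp (norm (x i)) - 1) \<le> (\<Prod>i\<in>I. exp (d / 2) - 1)"
        using x by (intro prod_mono) (auto simp: Ind_def less_imp_le)
      then show "(\<Prod>i\<in>I. exp (norm (x i)) - 1) \<le> (exp (d / 2) - 1) ^ card I"
        by simp
    qed
    also have "\<dots> < 1"
      using d by simp
    finally show "(\<Sum>I\<in>Ind H - {{}}. \<Prod>i\<in>I. exp (norm (x i)) - 1) < 1" .
  qed
qed

section \<open>The formal identities and their analytic form\<close>

theorem proposition4:
  fixes p :: nat and H :: "nat pair_pre_digraph"
  assumes "pair_graph H" and "pverts H = {1..p}"
  shows
    "(Abs_mfps (\<lambda>l. if Poly_Mapping.keys l \<subseteq> {1..p}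
         then smult (1 / (\<Prod>i=1..p. fact (Poly_Mapping.lookup l i))) (chromatic_poly (blowup H (Poly_Mapping.lookup l)))
         else 0) :: (nat, complex poly) mfps)
       = mfps_pow (B_series H) [:0, 1:]
     \<and> (\<forall>q. (Abs_mfps (\<lambda>l. if Poly_Mapping.keys l \<subseteq> {1..p}
         then poly (chromatic_poly (blowup H (Poly_Mapping.lookup l))) q / (\<Prod>i=1..p. fact (Poly_Mapping.lookup l i))
         else 0) :: (nat, complex) mfps)
       = mfps_pow (B_series H) q)
     \<and> B_fun H (\<lambda>_. 0) = 1
     \<and> (\<exists>r>0. \<forall>x :: nat \<Rightarrow> complex. (\<forall>i\<in>{1..p}. norm (x i) < r) \<longrightarrow>
         B_fun H x \<notin> \<real>\<^sub>\<le>\<^sub>0 \<and>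
         (\<forall>q. ((\<lambda>l. poly (chromatic_poly (blowup H (Poly_Mapping.lookup l))) q
                     * (\<Prod>i=1..p. x i ^ Poly_Mapping.lookup l i / fact (Poly_Mapping.lookup l i)))
               has_sum exp (q * Ln (B_fun H x))) {l. Poly_Mapping.keys l \<subseteq> {1..p}}))"
proof (intro conjI allI)
  note nth = mfps_nth_B_series_pow[OF assms(1), unfolded assms(2)]
  have fin: "finite (pverts H)"
    by (simp add: assms(2))
  show "(Abs_mfps (\<lambda>l. if Poly_Mapping.keys l \<subseteq> {1..p}
         then smult (1 / (\<Prod>i=1..p. fact (Poly_Mapping.lookup l i))) (chromatic_poly (blowup H (Poly_Mapping.lookup l)))
         else 0) :: (nat, complex poly) mfps) = mfps_pow (B_series H) [:0, 1:]"
    by (rule mfps_eqI)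
       (simp only: mfps_nth_Abs mfps_nth_B_series_pow_poly[OF assms(1), unfolded assms(2)])
  show "(Abs_mfps (\<lambda>l. if Poly_Mapping.keys l \<subseteq> {1..p}
         then poly (chromatic_poly (blowup H (Poly_Mapping.lookup l))) q / (\<Prod>i=1..p. fact (Poly_Mapping.lookup l i))
         else 0) :: (nat, complex) mfps) = mfps_pow (B_series H) q" for q
    by (rule mfps_eqI) (simp only: mfps_nth_Abs nth)
  show "B_fun H (\<lambda>_. 0) = 1"
    by (rule B_fun_0[OF fin])
  obtain r :: real where r: "r > 0" "\<And>x :: nat \<Rightarrow> complex. \<forall>i\<in>{1..p}. norm (x i) < r \<Longrightarrow>
      (\<Sum>I\<in>Ind H - {{}}. \<Prod>i\<in>I. exp (norm (x i)) - 1) < 1"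
    using independent_sum_bound_less_1[OF fin] unfolding assms(2) by blast
  show "\<exists>r>0. \<forall>x :: nat \<Rightarrow> complex. (\<forall>i\<in>{1..p}. norm (x i) < r) \<longrightarrow>
         B_fun H x \<notin> \<real>\<^sub>\<le>\<^sub>0 \<and>
         (\<forall>q. ((\<lambda>l. poly (chromatic_poly (blowup H (Poly_Mapping.lookup l))) q
                     * (\<Prod>i=1..p. x i ^ Poly_Mapping.lookup l i / fact (Poly_Mapping.lookup l i)))
               has_sum exp (q * Ln (B_fun H x))) {l. Poly_Mapping.keys l \<subseteq> {1..p}})"
  proof (intro exI conjI allI impI)
    show "r > 0"
      by (rule r(1))
    fix x :: "nat \<Rightarrow> complex" assume "\<forall>i\<in>{1..p}. norm (x i) < r"
    note less = r(2)[OF this]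
    note sums = mfps_sums_B_series_minus_1[OF fin, of x]
    \<comment> \<open>The value lies in the open unit disc about 1, hence in the right half-plane,
      away from the branch cut and from 0.\<close>
    have "norm (1 - B_fun H x) < 1"
      using mfps_sums_norm_le[OF sums] less by (simp add: norm_minus_commute)
    then have "Re (B_fun H x) > 0"
      using complex_Re_le_cmod[of "1 - B_fun H x"] by simp
    then show notin: "B_fun H x \<notin> \<real>\<^sub>\<le>\<^sub>0"
      by (simp add: complex_nonpos_Reals_iff)
    fix q
    have "((\<lambda>m. mfps_nth (mfps_pow (B_series H) q) m * mono_eval x m) has_sum (B_fun H x powr q)) UNIV"
      using has_sum_mfps_pow[OF B_series_nth_0[OF assms(1)] sums less, of q] by simp
    also have "B_fun H x powr q = exp (q * Ln (B_fun H x))"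
      using notin by (auto simp: powr_def)
    finally have "((\<lambda>m. mfps_nth (mfps_pow (B_series H) q) m * mono_eval x m) has_sum
      exp (q * Ln (B_fun H x))) UNIV" .
    \<comment> \<open>Exponents involving variables outside \<open>{1..p}\<close> have coefficient
      zero; on the others the factorials move from the coefficient into the monomial.\<close>
    moreover have "((\<lambda>l. poly (chromatic_poly (blowup H (Poly_Mapping.lookup l))) q
          * (\<Prod>i=1..p. x i ^ Poly_Mapping.lookup l i / fact (Poly_Mapping.lookup l i)))
        has_sum s) {l. Poly_Mapping.keys l \<subseteq> {1..p}} \<longleftrightarrow>
        ((\<lambda>m. mfps_nth (mfps_pow (B_series H) q) m * mono_eval x m) has_sum s) UNIV" for s
      by (rule has_sum_cong_neutral)
         (auto simp: nth mono_eval_superset[of "{1..p}"] prod_dividef)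
    ultimately show "((\<lambda>l. poly (chromatic_poly (blowup H (Poly_Mapping.lookup l))) q
                     * (\<Prod>i=1..p. x i ^ Poly_Mapping.lookup l i / fact (Poly_Mapping.lookup l i)))
               has_sum exp (q * Ln (B_fun H x))) {l. Poly_Mapping.keys l \<subseteq> {1..p}}"
      by blast
  qed
qed

end
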